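(* Let $\mathbb{K}$ be an algebraically closed field of characteristic zero, $s\ge1$, and $p\in\mathbb{K}[x_1,\dots,x_s,y_1,\dots,y_s]$. Consider Algorithm 1 described in the context. Then: (Soundness) if Algorithm 1 returns a pair $(A^*,B^* )$ with $A^*\in\mathbb{K}^{s\times1}$, $B^*\in\mathbb{K}^{s\times s}$, then $B^*$ is invertible and the sequence $X_n=(x_1(n),\dots,x_s(n))^\intercal$ defined by $X_{n+1}=B^*X_n$, $X_0=A^*$ satisfies $p(x_1(n),\dots,x_s(n),x_1(0),\dots,x_s(0))=0$ for all $n\in\mathbb{N}$; (Completeness) if there exist $A^*\in\mathbb{K}^{s\times1}$ and invertible $B^*\in\mathbb{K}^{s\times s}$ such that the sequence defined by $X_{n+1}=B^*X_n$, $X_0=A^*$ satisfies $p(x_1(n),\dots,x_s(n),x_1(0),\dots,x_s(0))=0$ for all $n\in\mathbb{N}$, then Algorithm 1 returns some pair (it does not return nothing).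
   Context: Convention: $\mathbb{N}=\{0,1,\dots\}$, $0^0=1$. Algorithm 1: introduce a symbolic vector $A=(a_1,\dots,a_s)^\intercal$ and symbolic matrix $B=(b_{kl})_{s\times s}$. For each integer partition $m_1,\dots,m_t$ of $s$ (positive integers with sum $s$; finitely many), call an exact solver on the constraint set $\mathcal{C}^p_{AB}(m_1,\dots,m_t)$ defined below; the solver decides satisfiability over $\mathbb{K}$ and, if satisfiable, returns a satisfying assignment $\sigma$. At the first satisfiable partition return $(\sigma(A),\sigma(B))$; if none is satisfiable return nothing. $\mathcal{C}^p_{AB}(m_1,\dots,m_t)=\mathcal{C}_{\mathrm{roots}}\cup\mathcal{C}_{\mathrm{coeff}}\cup\mathcal{C}_{\mathrm{init}}\cup\mathcal{C}_{\mathrm{alg}}$, with additional unknowns $\omega_1,\dots,\omega_t$ and column vectors $C_{ij}$ ($i\le t$, $j\le m_i$) of symbols: $\mathcal{C}_{\mathrm{roots}}$: the coefficients (in $z$) of $\det(zI-B)-\prod_i(z-\omega_i)^{m_i}$ equal $0$; $\omega_i\neq\omega_j$ for $i\neq j$; $\omega_i\neq0$. $\mathcal{C}_{\mathrm{coeff}}$: all entries of $\big(\sum_{k=j}^{m_i}\binom{k-1}{j-1}C_{ik}\omega_i\big)-BC_{ij}$ equal $0$. $\mathcal{C}_{\mathrm{init}}$: with $\hat X_n=\sum_{i,j}C_{ij}\omega_i^n n^{j-1}$, all entries of $\hat X_n-B^nA$ equal $0$ for $n=0,\dots,s-1$. $\mathcal{C}_{\mathrm{alg}}$: substituting the entries $\hat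 x_k(n)$ of $\hat X_n$ and $y_k:=a_k$ into $p$ and expanding formally (with $n$ an indeterminate and $\omega_{i_1}^n\cdots\omega_{i_r}^n=(\omega_{i_1}\cdots\omega_{i_r})^n$) gives $\sum_{e=0}^K n^e\sum_{j=1}^{\ell_e}w_{e,j}^nu_{e,j}$ with pairwise distinct monomials $w_{e,j}$ in $\vec\omega$ and polynomials $u_{e,j}$ in $\vec a,\vec c$; the constraints are $\sum_j w_{e,j}^r u_{e,j}=0$ for $0\le e\le K$, $0\le r\le\ell_e-1$. *)

theory Defs
  imports
    "HOL-Library.Poly_Mapping"
    "HOL-Library.Multiset"
    "HOL-Computational_Algebra.Polynomial"
    "Jordan_Normal_Form.Matrix"
    "Jordan_Normal_Form.Char_Poly"
begin

text \<open>
  A multivariate polynomial is a finitely supported map from monomials (finitely supported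
  exponent maps) to coefficients; its ring operations are those of \<^theory>\<open>HOL-Library.Poly_Mapping\<close>.
\<close>

type_synonym ('v, 'a) mpoly = "('v \<Rightarrow>\<^sub>0 nat) \<Rightarrow>\<^sub>0 'a"

definition mvar :: "'v \<Rightarrow> ('v, 'a::comm_ring_1) mpoly" where
  "mvar v = Poly_Mapping.single (Poly_Mapping.single v 1) 1"

definition mconst :: "'a::comm_ring_1 \<Rightarrow> ('v, 'a) mpoly" where
  "mconst c = Poly_Mapping.single 0 c"

definition mvars :: "('v, 'a::zero) mpoly \<Rightarrow> 'v set" where
  "mvars q = (\<Union>m\<in>Poly_Mapping.keys q. Poly_Mapping.keys m)"

definition monom_value :: "('v \<Rightarrow> 'b::comm_ring_1) \<Rightarrow> ('v \<Rightarrow>\<^sub>0 nat) \<Rightarrow> 'b" where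
  "monom_value f m = (\<Prod>v\<in>Poly_Mapping.keys m. f v ^ Poly_Mapping.lookup m v)"

definition mpoly_subst ::
    "('a::zero \<Rightarrow> 'b::comm_ring_1) \<Rightarrow> ('v \<Rightarrow> 'b) \<Rightarrow> ('v, 'a) mpoly \<Rightarrow> 'b" where
  "mpoly_subst h f q =
     (\<Sum>m\<in>Poly_Mapping.keys q. h (Poly_Mapping.lookup q m) * monom_value f m)"

definition mpoly_eval :: "('v \<Rightarrow> 'a::comm_ring_1) \<Rightarrow> ('v, 'a) mpoly \<Rightarrow> 'a" where
  "mpoly_eval \<sigma> q = mpoly_subst (\<lambda>c. c) \<sigma> q"


text \<open>
  The variables of the input polynomial. Matrix and vector coordinates are numbered from 0, so
  \<open>XV k\<close> and \<open>YV k\<close> with \<open>k < s\<close> stand for $x_{k+1}$ and $y_{k+1}$.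
\<close>

datatype xyvar = XV nat | YV nat

primrec lin_seq :: "'a::comm_ring_1 vec \<Rightarrow> 'a mat \<Rightarrow> nat \<Rightarrow> 'a vec" where
  "lin_seq A B 0 = A"
| "lin_seq A B (Suc n) = B *\<^sub>v lin_seq A B n"

definition poly_invariant :: "(xyvar, 'a::comm_ring_1) mpoly \<Rightarrow> 'a vec \<Rightarrow> 'a mat \<Rightarrow> bool" where
  "poly_invariant p A B \<longleftrightarrow>
     (\<forall>n. mpoly_eval (\<lambda>v. case v of XV k \<Rightarrow> lin_seq A B n $ k | YV k \<Rightarrow> lin_seq A B 0 $ k) p = 0)"


text \<open>
  The unknowns: \<open>Sa k\<close> and \<open>Sb k l\<close> are the entries of the symbolic vector and matrix,
  \<open>Sw i\<close> is $\omega_i$, and \<open>Sc i j k\<close> is entry \<open>k\<close> of the vector $C_{ij}$. The index \<open>i\<close> is a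
  position in the list \<open>ms\<close> of multiplicities and starts at 0; \<open>j\<close> starts at 1, as it enters
  the formulas through $n^{j-1}$ and binomial coefficients.
\<close>

datatype symb = Sa nat | Sb nat nat | Sw nat | Sc nat nat nat

type_synonym 'a spoly = "(symb, 'a) mpoly"

datatype 'p zero_test = EqZero 'p | NeqZero 'p

type_synonym 'a constraint = "'a spoly zero_test"

primrec holds :: "(symb \<Rightarrow> 'a::comm_ring_1) \<Rightarrow> 'a constraint \<Rightarrow> bool" where
  "holds \<sigma> (EqZero q) \<longleftrightarrow> mpoly_eval \<sigma> q = 0"
| "holds \<sigma> (NeqZero q) \<longleftrightarrow> mpoly_eval \<sigma> q \<noteq> 0"

definition satisfies :: "(symb \<Rightarrow> 'a::comm_ring_1) \<Rightarrow> 'a constraint set \<Rightarrow> bool" where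
  "satisfies \<sigma> cs \<longleftrightarrow> (\<forall>c\<in>cs. holds \<sigma> c)"

definition sym_vec :: "nat \<Rightarrow> 'a::comm_ring_1 spoly vec" where
  "sym_vec s = vec s (\<lambda>k. mvar (Sa k))"

definition sym_mat :: "nat \<Rightarrow> 'a::comm_ring_1 spoly mat" where
  "sym_mat s = mat s s (\<lambda>(k, l). mvar (Sb k l))"

definition sym_C :: "nat \<Rightarrow> nat \<Rightarrow> nat \<Rightarrow> 'a::comm_ring_1 spoly vec" where
  "sym_C s i j = vec s (\<lambda>k. mvar (Sc i j k))"

definition C_roots :: "nat \<Rightarrow> nat list \<Rightarrow> 'a::comm_ring_1 constraint set" where
  "C_roots s ms =
     EqZero ` set (coeffs (char_poly (sym_mat s)
                           - (\<Prod>i<length ms. [:- mvar (Sw i), 1:] ^ (ms ! i))))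
     \<union> {NeqZero (mvar (Sw i) - mvar (Sw j)) | i j. i < length ms \<and> j < length ms \<and> i \<noteq> j}
     \<union> {NeqZero (mvar (Sw i)) | i. i < length ms}"

definition C_coeff :: "nat \<Rightarrow> nat list \<Rightarrow> 'a::comm_ring_1 constraint set" where
  "C_coeff s ms =
     {EqZero ((\<Sum>k=j..ms ! i. of_nat ((k - 1) choose (j - 1)) * (sym_C s i k $ l) * mvar (Sw i))
              - (sym_mat s *\<^sub>v sym_C s i j) $ l)
      | i j l. i < length ms \<and> 1 \<le> j \<and> j \<le> ms ! i \<and> l < s}"

definition C_init :: "nat \<Rightarrow> nat list \<Rightarrow> 'a::comm_ring_1 constraint set" where
  "C_init s ms =
     {EqZero ((\<Sum>i<length ms. \<Sum>j=1..ms ! i.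
                 (sym_C s i j $ l) * mvar (Sw i) ^ n * of_nat n ^ (j - 1))
              - ((sym_mat s ^\<^sub>m n) *\<^sub>v sym_vec s) $ l)
      | n l. n < s \<and> l < s}"

text \<open>
  Formal exponential polynomials in an indeterminate \<open>n\<close>: an element \<open>F\<close> of the monoid algebra
  below stands for $\sum_w w^n F_w(n)$, where \<open>w\<close> ranges over formal monomials in the $\omega_i$
  (exponent maps on the index \<open>i\<close>) and $F_w$ is a polynomial in \<open>n\<close> whose coefficients are
  polynomials in the unknowns. Multiplication in the monoid algebra implements the rule
  $\omega_{i_1}^n \cdots \omega_{i_r}^n = (\omega_{i_1} \cdots \omega_{i_r})^n$.
\<close>

type_synonym 'a exp_poly = "(nat \<Rightarrow>\<^sub>0 nat) \<Rightarrow>\<^sub>0 'a spoly poly"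

definition formal_xhat :: "nat \<Rightarrow> nat list \<Rightarrow> nat \<Rightarrow> 'a::comm_ring_1 exp_poly" where
  "formal_xhat s ms k =
     (\<Sum>i<length ms. \<Sum>j=1..ms ! i.
        Poly_Mapping.single (Poly_Mapping.single i 1) (Polynomial.monom (sym_C s i j $ k) (j - 1)))"

definition formal_expansion ::
    "nat \<Rightarrow> (xyvar, 'a::comm_ring_1) mpoly \<Rightarrow> nat list \<Rightarrow> 'a exp_poly" where
  "formal_expansion s p ms =
     mpoly_subst (\<lambda>c. Poly_Mapping.single 0 [:mconst c:])
       (\<lambda>v. case v of XV k \<Rightarrow> formal_xhat s ms k
                    | YV k \<Rightarrow> Poly_Mapping.single 0 [:sym_vec s $ k:]) p"

definition expansion_coeff :: "'a::comm_ring_1 exp_poly \<Rightarrow> nat \<Rightarrow> (nat \<Rightarrow>\<^sub>0 nat) \<Rightarrow> 'a spoly" where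
  "expansion_coeff F e w = Polynomial.coeff (Poly_Mapping.lookup F w) e"

definition expansion_monoms :: "'a::comm_ring_1 exp_poly \<Rightarrow> nat \<Rightarrow> (nat \<Rightarrow>\<^sub>0 nat) set" where
  "expansion_monoms F e = {w. expansion_coeff F e w \<noteq> 0}"

definition expansion_degree :: "'a::comm_ring_1 exp_poly \<Rightarrow> nat" where
  "expansion_degree F =
     Max (insert 0 ((\<lambda>w. Polynomial.degree (Poly_Mapping.lookup F w)) ` Poly_Mapping.keys F))"

definition C_alg ::
    "nat \<Rightarrow> (xyvar, 'a::comm_ring_1) mpoly \<Rightarrow> nat list \<Rightarrow> 'a constraint set" where
  "C_alg s p ms =
     (let F = formal_expansion s p ms in
      {EqZero (\<Sum>w\<in>expansion_monoms F e.
                 monom_value (\<lambda>i. mvar (Sw i)) w ^ r * expansion_coeff F e w)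
       | e r. e \<le> expansion_degree F \<and> r < card (expansion_monoms F e)})"

definition constraints ::
    "nat \<Rightarrow> (xyvar, 'a::comm_ring_1) mpoly \<Rightarrow> nat list \<Rightarrow> 'a constraint set" where
  "constraints s p ms = C_roots s ms \<union> C_coeff s ms \<union> C_init s ms \<union> C_alg s p ms"


type_synonym 'a solver = "'a constraint set \<Rightarrow> (symb \<Rightarrow> 'a) option"

definition exact_solver :: "('a::comm_ring_1) solver \<Rightarrow> bool" where
  "exact_solver solve \<longleftrightarrow>
     (\<forall>cs. finite cs \<longrightarrow>
        (case solve cs of Some \<sigma> \<Rightarrow> satisfies \<sigma> cs | None \<Rightarrow> \<not> (\<exists>\<sigma>. satisfies \<sigma> cs)))"

text \<open>
  An integer partition is a multiset of positive integers. The list \<open>parts\<close> runs through all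
  partitions of \<open>s\<close>, in any order, each one given by some arrangement of its parts.
\<close>

definition enumerates_partitions :: "nat \<Rightarrow> nat list list \<Rightarrow> bool" where
  "enumerates_partitions s parts \<longleftrightarrow> mset ` set parts = {M. 0 \<notin># M \<and> sum_mset M = s}"

primrec algorithm1 ::
    "('a::comm_ring_1) solver \<Rightarrow> nat \<Rightarrow> (xyvar, 'a) mpoly \<Rightarrow> nat list list \<Rightarrow> ('a vec \<times> 'a mat) option"
  where
  "algorithm1 solve s p [] = None"
| "algorithm1 solve s p (ms # parts) =
     (case solve (constraints s p ms) of
        Some \<sigma> \<Rightarrow> Some (vec s (\<lambda>k. \<sigma> (Sa k)), mat s s (\<lambda>(k, l). \<sigma> (Sb k l)))
      | None \<Rightarrow> algorithm1 solve s p parts)"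

end

theory Submission
  imports Defs
begin

text \<open>
  An exponential polynomial \<open>\<Sum>w. W w ^ n * U w n\<close> with nonzero \<open>W w\<close> vanishes for all \<open>n\<close> iff
  \<open>\<Sum>w. W w ^ r * coeff (U w) e = 0\<close> for all \<open>e\<close> and \<open>r\<close>: group the \<open>w\<close> with equal \<open>W w\<close> and use
  that the sequences \<open>n ^ e * \<nu> ^ n\<close> are linearly independent in characteristic zero. For fixed \<open>e\<close>
  only the values of \<open>r\<close> below the number of summands matter, because every power of \<open>W w\<close> can be
  reduced modulo the polynomial with roots \<open>W w\<close>. This translates \<open>C_alg\<close>.

  Soundness: the coefficient constraints say that the candidate \<open>X\<close> satisfies \<open>X (n + 1) = B X n\<close>.
  Completeness: by a Cayley--Hamilton argument for the shift operator, each entry of a solution is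
  annihilated by \<open>char_poly B\<close> evaluated at the shift. Splitting off the linear factors one at a time
  shows that it is an exponential polynomial with the eigenvalues of \<open>B\<close> as bases and with degrees
  bounded by their multiplicities; the partition is the list of these multiplicities.
\<close>

subsection \<open>Substitution into polynomials\<close>

lemma poly_mapping_eq_sum_single:
  "q = (\<Sum>m\<in>Poly_Mapping.keys q. Poly_Mapping.single m (Poly_Mapping.lookup q m))"
  by (rule poly_mapping_eqI)
    (simp add: lookup_sum lookup_single when_def sum.delta in_keys_iff)

lemma monom_value_superset:
  assumes "finite S" "Poly_Mapping.keys m \<subseteq> S"
  shows "monom_value f m = (\<Prod>v\<in>S. f v ^ Poly_Mapping.lookup m v)"
  unfolding monom_value_def
  by (rule prod.mono_neutral_left) (use assms in \<open>auto simp: in_keys_iff\<close>)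

lemma monom_value_0 [simp]: "monom_value f 0 = 1"
  by (simp add: monom_value_def)

lemma monom_value_single [simp]: "monom_value f (Poly_Mapping.single v k) = f v ^ k"
  by (simp add: monom_value_def)

lemma monom_value_add: "monom_value f (m + m') = monom_value f m * monom_value f m'"
proof -
  let ?S = "Poly_Mapping.keys m \<union> Poly_Mapping.keys m'"
  have "monom_value f (m + m') = (\<Prod>v\<in>?S. f v ^ Poly_Mapping.lookup (m + m') v)"
    by (rule monom_value_superset) (simp_all add: Poly_Mapping.keys_add)
  also have "\<dots> = (\<Prod>v\<in>?S. f v ^ Poly_Mapping.lookup m v) * (\<Prod>v\<in>?S. f v ^ Poly_Mapping.lookup m' v)"
    by (simp add: lookup_add power_add prod.distrib)
  also have "\<dots> = monom_value f m * monom_value f m'"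
    by (simp add: monom_value_superset[of ?S])
  finally show ?thesis .
qed

lemma monom_value_power: "monom_value (\<lambda>v. f v ^ n) m = monom_value f m ^ n"
  by (simp add: monom_value_def prod_power_distrib power_mult[symmetric] mult.commute)

lemma (in comm_ring_hom) hom_monom_value: "hom (monom_value f m) = monom_value (\<lambda>v. hom (f v)) m"
  by (simp add: monom_value_def hom_distribs)

lemma (in comm_ring_hom) hom_mpoly_subst:
  "hom (mpoly_subst h f q) = mpoly_subst (\<lambda>c. hom (h c)) (\<lambda>v. hom (f v)) q"
  by (simp add: mpoly_subst_def hom_monom_value hom_distribs)

lemma mpoly_subst_cong:
  assumes "\<And>v. v \<in> mvars q \<Longrightarrow> f v = g v"
  shows "mpoly_subst h f q = mpoly_subst h g q"
proof -
  have "f v = g v" if "m \<in> Poly_Mapping.keys q" "v \<in> Poly_Mapping.keys m" for m v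
    using that by (intro assms) (auto simp: mvars_def)
  then show ?thesis
    unfolding mpoly_subst_def monom_value_def by simp
qed

context comm_ring_hom
begin

lemma mpoly_subst_superset:
  assumes "finite S" "Poly_Mapping.keys q \<subseteq> S"
  shows "mpoly_subst hom f q = (\<Sum>m\<in>S. hom (Poly_Mapping.lookup q m) * monom_value f m)"
  unfolding mpoly_subst_def
  by (rule sum.mono_neutral_left) (use assms in \<open>auto simp: in_keys_iff\<close>)

lemma mpoly_subst_single [simp]:
  "mpoly_subst hom f (Poly_Mapping.single m c) = hom c * monom_value f m"
  by (cases "c = 0") (simp_all add: mpoly_subst_def)

lemma mpoly_subst_add:
  "mpoly_subst hom f (q + r) = mpoly_subst hom f q + mpoly_subst hom f r"
proof -
  let ?S = "Poly_Mapping.keys q \<union> Poly_Mapping.keys r"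
  have "mpoly_subst hom f (q + r) = (\<Sum>m\<in>?S. hom (Poly_Mapping.lookup (q + r) m) * monom_value f m)"
    by (rule mpoly_subst_superset) (simp_all add: Poly_Mapping.keys_add)
  then show ?thesis
    by (simp add: lookup_add hom_add distrib_right sum.distrib mpoly_subst_superset[of ?S])
qed

lemma mpoly_subst_sum: "mpoly_subst hom f (\<Sum>x\<in>X. g x) = (\<Sum>x\<in>X. mpoly_subst hom f (g x))"
  by (induction X rule: infinite_finite_induct)
    (simp_all add: mpoly_subst_add, simp_all add: mpoly_subst_def)

text \<open>Expanding both factors into single terms reduces the claim to multiplicativity of
  \<open>hom\<close> and to the additivity of exponents in \<open>monom_value_add\<close>.\<close>

lemma mpoly_subst_mult:
  "mpoly_subst hom f (q * r) = mpoly_subst hom f q * mpoly_subst hom f r"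
proof -
  let ?t = "\<lambda>q m. Poly_Mapping.single m (Poly_Mapping.lookup q m)"
  have "q * r = (\<Sum>m\<in>Poly_Mapping.keys q. ?t q m) * (\<Sum>m\<in>Poly_Mapping.keys r. ?t r m)"
    by (simp flip: poly_mapping_eq_sum_single)
  also have "mpoly_subst hom f \<dots> = mpoly_subst hom f q * mpoly_subst hom f r"
    by (simp add: sum_product mult_single mpoly_subst_sum hom_mult monom_value_add
        mpoly_subst_def[of hom f q] mpoly_subst_def[of hom f r] algebra_simps)
  finally show ?thesis .
qed

text \<open>This is used twice: for \<open>mpoly_eval\<close> on the constraint polynomials, and in
  \<open>eval_formal_expansion\<close> for the map that collapses a formal exponential polynomial to
  its value at a fixed \<open>n\<close>.\<close>

lemma comm_ring_hom_mpoly_subst: "comm_ring_hom (mpoly_subst hom f)"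
proof
  show "mpoly_subst hom f 1 = 1"
    using mpoly_subst_single[of f 0 1] by simp
  show "mpoly_subst hom f 0 = 0"
    by (simp add: mpoly_subst_def)
qed (fact mpoly_subst_add mpoly_subst_mult)+


end

lemma comm_ring_hom_id: "comm_ring_hom (\<lambda>c. c)"
  by standard simp_all

lemma comm_ring_hom_poly: "comm_ring_hom (\<lambda>P. poly P x)"
  by standard simp_all

lemma comm_ring_hom_comp: "comm_ring_hom g \<Longrightarrow> comm_ring_hom h \<Longrightarrow> comm_ring_hom (\<lambda>x. g (h x))"
proof -
  assume "comm_ring_hom g" "comm_ring_hom h"
  then interpret g: comm_ring_hom g + h: comm_ring_hom h .
  show ?thesis
    by standard (simp_all add: g.hom_add h.hom_add g.hom_mult h.hom_mult)
qed

lemma comm_ring_hom_mpoly_eval: "comm_ring_hom (mpoly_eval \<sigma>)"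
  unfolding mpoly_eval_def by (rule comm_ring_hom.comm_ring_hom_mpoly_subst[OF comm_ring_hom_id])

lemma mpoly_eval_mvar [simp]: "mpoly_eval \<sigma> (mvar v) = \<sigma> v"
  by (simp add: mpoly_eval_def mvar_def comm_ring_hom.mpoly_subst_single[OF comm_ring_hom_id])

lemma mpoly_eval_mconst [simp]: "mpoly_eval \<sigma> (mconst c) = c"
  by (simp add: mpoly_eval_def mconst_def comm_ring_hom.mpoly_subst_single[OF comm_ring_hom_id])

subsection \<open>Exponential polynomials\<close>

text \<open>Modulo the monic polynomial \<open>P\<close> with roots \<open>W w\<close>, the
  \<open>n\<close>-th power of the indeterminate is a polynomial \<open>R\<close> of degree below
  \<open>card S\<close>, so every power sum is a linear combination of the first
  \<open>card S\<close> ones. The values \<open>W w\<close> may coincide, as distinct formal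
  monomials can evaluate to the same number.\<close>

lemma sum_powers_eq_0_if_initial:
  fixes W u :: "'b \<Rightarrow> 'a::field"
  assumes "finite S" and vanish: "\<And>r. r < card S \<Longrightarrow> (\<Sum>w\<in>S. W w ^ r * u w) = 0"
  shows "(\<Sum>w\<in>S. W w ^ n * u w) = 0"
proof (cases "S = {}")
  case False
  define P where "P = (\<Prod>w\<in>S. [:- W w, 1:])"
  define R where "R = monom 1 n mod P"
  have degP: "degree P = card S" and "P \<noteq> 0"
    unfolding P_def using \<open>finite S\<close> by (simp_all add: degree_prod_eq_sum_degree)
  have "degree R < card S"
    using degree_mod_less'[of P "monom 1 n"] \<open>P \<noteq> 0\<close> False \<open>finite S\<close>
    by (cases "R = 0") (auto simp: degP R_def card_gt_0_iff)
  have "W w ^ n = (\<Sum>r<card S. coeff R r * W w ^ r)" if "w \<in> S" for w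
  proof -
    have "poly P (W w) = 0"
      unfolding P_def poly_prod using that \<open>finite S\<close> by (auto intro: prod_zero)
    have "W w ^ n = poly (monom 1 n div P * P + R) (W w)"
      unfolding R_def by (simp add: poly_monom)
    also have "\<dots> = poly R (W w)"
      using \<open>poly P (W w) = 0\<close> by simp
    also have "\<dots> = (\<Sum>r<card S. coeff R r * W w ^ r)"
      unfolding poly_altdef using \<open>degree R < card S\<close>
      by (intro sum.mono_neutral_left) (auto simp: coeff_eq_0)
    finally show ?thesis .
  qed
  then have "(\<Sum>w\<in>S. W w ^ n * u w) = (\<Sum>w\<in>S. \<Sum>r<card S. coeff R r * (W w ^ r * u w))"
    by (simp add: sum_distrib_right mult.assoc)
  also have "\<dots> = (\<Sum>r<card S. coeff R r * (\<Sum>w\<in>S. W w ^ r * u w))"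
    by (subst sum.swap) (simp add: sum_distrib_left)
  finally show ?thesis
    by (simp add: vanish)
qed simp

text \<open>Binomial expansion of \<open>q(x + 1)\<close>, obtained from Pascal's rule along the
  Horner form of \<open>q\<close>. The bound \<open>m\<close> counts coefficients instead of using
  the degree, so that it can later be a multiplicity and also covers \<open>q = 0\<close>.\<close>

lemma coeff_pcompose_shift:
  fixes q :: "'a::comm_ring_1 poly"
  assumes "\<forall>j\<ge>m. coeff q j = 0"
  shows "coeff (pcompose q [:1, 1:]) i = (\<Sum>j<m. of_nat (j choose i) * coeff q j)"
  using assms
proof (induction q arbitrary: m i)
  case (pCons a q)
  show ?case
  proof (cases m)
    case 0
    then have "pCons a q = 0"
      using pCons.prems by (intro poly_eqI) simp
    then show ?thesis
      using 0 by simp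
  next
    case (Suc m')
    have "\<forall>j\<ge>m'. coeff q j = 0"
      using pCons.prems Suc by (metis Suc_le_mono coeff_pCons_Suc)
    note IH = pCons.IH[OF this]
    show ?thesis
      unfolding Suc sum.lessThan_Suc_shift
      using IH[of 0]
      by (cases i) (simp_all add: pcompose_pCons IH coeff_pCons algebra_simps sum.distrib)
  qed
qed simp

text \<open>If \<open>y n = \<nu>^n * q n\<close>, then \<open>y (n + 1) - \<mu> * y n = \<nu>^n * exp_shift \<mu> \<nu> q n\<close>.\<close>

definition exp_shift :: "'a::comm_ring_1 \<Rightarrow> 'a \<Rightarrow> 'a poly \<Rightarrow> 'a poly" where
  "exp_shift \<mu> \<nu> q = Polynomial.smult \<nu> (pcompose q [:1, 1:]) - Polynomial.smult \<mu> q"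

lemma poly_exp_shift: "poly (exp_shift \<mu> \<nu> q) x = \<nu> * poly q (x + 1) - \<mu> * poly q x"
  by (simp add: exp_shift_def poly_pcompose add.commute)

lemma exp_shift_add: "exp_shift \<mu> \<nu> (p + q) = exp_shift \<mu> \<nu> p + exp_shift \<mu> \<nu> q"
  by (simp add: exp_shift_def pcompose_add smult_add_right)

lemma coeff_exp_shift_eq_0:
  assumes "\<forall>j\<ge>m. coeff q j = 0" "i \<ge> m"
  shows "coeff (exp_shift \<mu> \<nu> q) i = 0"
  using assms by (simp add: exp_shift_def coeff_pcompose_shift[OF assms(1)] binomial_eq_0)

lemma coeff_exp_shift_top:
  assumes "\<forall>j\<ge>Suc m. coeff q j = 0"
  shows "coeff (exp_shift \<mu> \<nu> q) m = (\<nu> - \<mu>) * coeff q m"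
  by (simp add: exp_shift_def coeff_pcompose_shift[OF assms] binomial_eq_0 algebra_simps)

text \<open>For equal bases the top coefficients cancel and the next lower one takes the lead. In
  characteristic zero its factor \<open>of_nat (Suc m)\<close> can be inverted.\<close>

lemma coeff_exp_shift_same_top:
  assumes "\<forall>j\<ge>Suc (Suc m). coeff q j = 0"
  shows "coeff (exp_shift \<mu> \<mu> q) m = \<mu> * (of_nat (Suc m) * coeff q (Suc m))"
  by (simp add: exp_shift_def coeff_pcompose_shift[OF assms] binomial_eq_0 algebra_simps)

lemma exp_shift_inject:
  fixes q :: "'a::idom poly"
  assumes "\<nu> \<noteq> \<mu>" "exp_shift \<mu> \<nu> q = 0"
  shows "q = 0"
proof -
  have "(\<nu> - \<mu>) * coeff q (degree q) = 0"
    using assms(2) by (subst coeff_exp_shift_top[symmetric]) (auto simp: coeff_eq_0)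
  then show ?thesis
    using assms(1) by auto
qed

text \<open>Triangular solving from the top: a monomial \<open>t\<close> of the same degree accounts
  for the leading coefficient of \<open>q\<close>, and what remains has one coefficient
  fewer.\<close>

lemma exp_shift_surj:
  fixes q :: "'a::field poly"
  assumes "\<nu> \<noteq> \<mu>" "\<forall>j\<ge>m. coeff q j = 0"
  shows "\<exists>r. (\<forall>j\<ge>m. coeff r j = 0) \<and> exp_shift \<mu> \<nu> r = q"
  using assms(2)
proof (induction m arbitrary: q)
  case 0
  then have "q = 0"
    by (intro poly_eqI) simp
  then show ?case
    by (intro exI[of _ 0]) (simp add: exp_shift_def)
next
  case (Suc m)
  define t where "t = monom (coeff q m / (\<nu> - \<mu>)) m"
  have t: "\<forall>j\<ge>Suc m. coeff t j = 0"
    by (simp add: t_def)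
  have "coeff (q - exp_shift \<mu> \<nu> t) j = 0" if "j \<ge> m" for j
  proof (cases "j = m")
    case True
    then show ?thesis
      using assms(1) by (simp add: coeff_exp_shift_top[OF t]) (simp add: t_def)
  next
    case False
    then show ?thesis
      using Suc.prems that coeff_exp_shift_eq_0[OF t, of j] by simp
  qed
  then obtain r where r: "\<forall>j\<ge>m. coeff r j = 0" "exp_shift \<mu> \<nu> r = q - exp_shift \<mu> \<nu> t"
    using Suc.IH by blast
  show ?case
    by (intro exI[of _ "r + t"]) (use r t in \<open>simp add: exp_shift_add\<close>)
qed

text \<open>The resonant case: the operator lowers the degree, so a preimage needs one more
  coefficient. This is why a root of multiplicity \<open>m\<close> allows polynomial factors with
  \<open>m\<close> coefficients.\<close>

lemma exp_shift_same_surj: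
  fixes q :: "'a::field_char_0 poly"
  assumes "\<mu> \<noteq> 0" "\<forall>j\<ge>m. coeff q j = 0"
  shows "\<exists>r. (\<forall>j\<ge>Suc m. coeff r j = 0) \<and> exp_shift \<mu> \<mu> r = q"
  using assms(2)
proof (induction m arbitrary: q)
  case 0
  then have "q = 0"
    by (intro poly_eqI) simp
  then show ?case
    by (intro exI[of _ 0]) (simp add: exp_shift_def)
next
  case (Suc m)
  define c where "c = coeff q m / (\<mu> * of_nat (Suc m))"
  define t where "t = monom c (Suc m)"
  have "of_nat (Suc m) \<noteq> (0::'a)"
    by (rule of_nat_neq_0)
  then have c: "\<mu> * (of_nat (Suc m) * c) = coeff q m"
    using assms(1) by (simp add: c_def del: of_nat_Suc)
  have t: "\<forall>j\<ge>Suc (Suc m). coeff t j = 0"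
    by (simp add: t_def)
  have "coeff (q - exp_shift \<mu> \<mu> t) j = 0" if "j \<ge> m" for j
  proof -
    have "j = m \<or> j = Suc m \<or> j \<ge> Suc (Suc m)"
      using that by linarith
    then show ?thesis
    proof (elim disjE)
      assume 1: "j = m"
      have "coeff (exp_shift \<mu> \<mu> t) m = coeff q m"
        unfolding coeff_exp_shift_same_top[OF t] by (simp only: t_def coeff_monom simp_thms if_True c)
      then show ?thesis
        using 1 by simp
    next
      assume 2: "j = Suc m"
      then show ?thesis
        using Suc.prems by (simp add: coeff_exp_shift_top[OF t])
    next
      assume 3: "j \<ge> Suc (Suc m)"
      then show ?thesis
        using Suc.prems coeff_exp_shift_eq_0[OF t, of j] by simp
    qed
  qed
  then obtain r where r: "\<forall>j\<ge>Suc m. coeff r j = 0" "exp_shift \<mu> \<mu> r = q - exp_shift \<mu> \<mu> t"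
    using Suc.IH by blast
  show ?case
    by (intro exI[of _ "r + t"]) (use r t in \<open>simp add: exp_shift_add\<close>)
qed

section \<open>Linear independence of exponential polynomials\<close>

lemma poly_eq_0_if_zero_at_nats:
  fixes q :: "'a::field_char_0 poly"
  assumes "\<And>n. poly q (of_nat n) = 0"
  shows "q = 0"
proof (rule ccontr)
  assume "q \<noteq> 0"
  have "range of_nat \<subseteq> {x. poly q x = 0}"
    using assms by auto
  then have "finite (range (of_nat :: nat \<Rightarrow> 'a))"
    using poly_roots_finite[OF \<open>q \<noteq> 0\<close>] finite_subset by blast
  moreover have "infinite (range (of_nat :: nat \<Rightarrow> 'a))"
    by (intro range_inj_infinite injI) simp
  ultimately show False
    by blast
qed

text \<open>A nested induction: over the set of bases and, for the new base \<open>\<mu>\<close>,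
  over the number \<open>d\<close> of coefficients of \<open>q \<mu>\<close>. Applying the shift
  minus \<open>\<mu>\<close> removes a coefficient at \<open>\<mu>\<close> and is injective at the
  other bases; at \<open>d = 0\<close> the base \<open>\<mu>\<close> drops out.\<close>

lemma exp_poly_independent:
  fixes q :: "'a::field_char_0 \<Rightarrow> 'a poly"
  assumes "finite S" "0 \<notin> S" "\<And>n. (\<Sum>\<nu>\<in>S. \<nu> ^ n * poly (q \<nu>) (of_nat n)) = 0"
  shows "\<forall>\<nu>\<in>S. q \<nu> = 0"
  using assms
proof (induction S arbitrary: q)
  case (insert \<mu> S)
  have vanish: "\<forall>\<nu>\<in>insert \<mu> S. q \<nu> = 0"
    if "\<forall>j\<ge>d. coeff (q \<mu>) j = 0"
       "\<And>n. (\<Sum>\<nu>\<in>insert \<mu> S. \<nu> ^ n * poly (q \<nu>) (of_nat n)) = 0" for d q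
    using that
  proof (induction d arbitrary: q)
    case 0
    then have "q \<mu> = 0"
      by (intro poly_eqI) simp
    moreover have "(\<Sum>\<nu>\<in>S. \<nu> ^ n * poly (q \<nu>) (of_nat n)) = 0" for n
      using 0(2)[of n] insert.hyps \<open>q \<mu> = 0\<close> by simp
    then have "\<forall>\<nu>\<in>S. q \<nu> = 0"
      using insert.prems(1) by (intro insert.IH) auto
    ultimately show ?case
      by simp
  next
    case (Suc d)
    let ?s = "\<lambda>n q. \<Sum>\<nu>\<in>insert \<mu> S. \<nu> ^ n * poly (q \<nu>) (of_nat n)"
    let ?r = "\<lambda>\<nu>. exp_shift \<mu> \<nu> (q \<nu>)"
    have eq: "?s n ?r = ?s (Suc n) q - \<mu> * ?s n q" for n
      by (subst sum_distrib_left, subst sum_subtractf[symmetric], rule sum.cong)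
        (simp_all add: poly_exp_shift algebra_simps)
    have s0: "?s n ?r = 0" for n
      unfolding eq Suc.prems(2) by simp
    have "coeff (?r \<mu>) j = 0" if "j \<ge> d" for j
      using that coeff_exp_shift_top[OF Suc.prems(1), of \<mu> \<mu>] coeff_exp_shift_eq_0[OF Suc.prems(1), of j \<mu> \<mu>]
      by (cases "j = d") simp_all
    then have r0: "\<forall>\<nu>\<in>insert \<mu> S. ?r \<nu> = 0"
      by (intro Suc.IH s0) auto
    have S0: "q \<nu> = 0" if "\<nu> \<in> S" for \<nu>
      using exp_shift_inject[of \<nu> \<mu> "q \<nu>"] r0 that insert.hyps by auto
    \<comment> \<open>Only the summand at \<open>\<mu>\<close> is left, and its power can be
      cancelled because \<open>\<mu>\<close> is nonzero.\<close>
    have "\<mu> ^ n * poly (q \<mu>) (of_nat n) = 0" for n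
      using Suc.prems(2)[of n] insert.hyps by (simp add: S0)
    then have "q \<mu> = 0"
      using insert.prems(1) by (intro poly_eq_0_if_zero_at_nats) auto
    then show ?case
      using S0 by auto
  qed
  have "\<forall>j\<ge>Suc (degree (q \<mu>)). coeff (q \<mu>) j = 0"
    by (simp add: coeff_eq_0)
  then show ?case
    using insert.prems(2) by (rule vanish)
qed simp

text \<open>Independence applies after merging all \<open>w\<close> with the same value into
  \<open>q \<nu>\<close>. Only the merged polynomials must vanish, not each \<open>U w\<close>,
  hence a conclusion about weighted sums.\<close>

lemma exp_poly_coeff_sums_eq_0:
  fixes W :: "'b \<Rightarrow> 'a::field_char_0" and U :: "'b \<Rightarrow> 'a poly"
  assumes "finite K" "\<And>w. w \<in> K \<Longrightarrow> W w \<noteq> 0"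
    and zero: "\<And>n. (\<Sum>w\<in>K. W w ^ n * poly (U w) (of_nat n)) = 0"
  shows "(\<Sum>w\<in>K. W w ^ r * coeff (U w) e) = 0"
proof -
  define q where "q \<nu> = (\<Sum>w | w \<in> K \<and> W w = \<nu>. U w)" for \<nu>
  have "(\<Sum>\<nu>\<in>W ` K. \<nu> ^ n * poly (q \<nu>) (of_nat n)) = 0" for n
  proof -
    have "(\<Sum>\<nu>\<in>W ` K. \<nu> ^ n * poly (q \<nu>) (of_nat n))
        = (\<Sum>\<nu>\<in>W ` K. \<Sum>w | w \<in> K \<and> W w = \<nu>. W w ^ n * poly (U w) (of_nat n))"
      by (simp add: q_def poly_sum sum_distrib_left)
    also have "\<dots> = (\<Sum>w\<in>K. W w ^ n * poly (U w) (of_nat n))"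
      by (rule sum.image_gen[OF \<open>finite K\<close>, symmetric])
    finally show ?thesis
      by (simp add: zero)
  qed
  then have q0: "\<forall>\<nu>\<in>W ` K. q \<nu> = 0"
    using assms by (intro exp_poly_independent) auto
  have "(\<Sum>w\<in>K. W w ^ r * coeff (U w) e)
      = (\<Sum>\<nu>\<in>W ` K. \<Sum>w | w \<in> K \<and> W w = \<nu>. W w ^ r * coeff (U w) e)"
    by (rule sum.image_gen[OF \<open>finite K\<close>])
  also have "\<dots> = (\<Sum>\<nu>\<in>W ` K. \<nu> ^ r * coeff (q \<nu>) e)"
    by (simp add: q_def coeff_sum sum_distrib_left)
  finally show ?thesis
    using q0 by simp
qed

text \<open>The converse direction: the sum is regrouped by powers of \<open>n\<close>, each of
  which multiplies one of the vanishing sums.\<close>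

lemma exp_poly_eq_0_if_coeff_sums_eq_0:
  fixes W :: "'b \<Rightarrow> 'a::comm_ring_1" and U :: "'b \<Rightarrow> 'a poly"
  assumes "finite K" and zero: "\<And>e r. (\<Sum>w\<in>K. W w ^ r * coeff (U w) e) = 0"
  shows "(\<Sum>w\<in>K. W w ^ n * poly (U w) (of_nat n)) = 0"
proof -
  define N where "N = Max (insert 0 ((\<lambda>w. degree (U w)) ` K))"
  have N: "degree (U w) \<le> N" if "w \<in> K" for w
    unfolding N_def using that \<open>finite K\<close> by (intro Max_ge) auto
  have "poly (U w) (of_nat n) = (\<Sum>e\<le>N. coeff (U w) e * of_nat n ^ e)" if "w \<in> K" for w
    unfolding poly_altdef using N[OF that]
    by (intro sum.mono_neutral_left) (auto simp: coeff_eq_0)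
  then have "(\<Sum>w\<in>K. W w ^ n * poly (U w) (of_nat n))
      = (\<Sum>w\<in>K. \<Sum>e\<le>N. of_nat n ^ e * (W w ^ n * coeff (U w) e))"
    by (simp add: sum_distrib_left algebra_simps)
  also have "\<dots> = (\<Sum>e\<le>N. of_nat n ^ e * (\<Sum>w\<in>K. W w ^ n * coeff (U w) e))"
    by (subst sum.swap) (simp add: sum_distrib_left)
  finally show ?thesis
    by (simp add: zero)
qed

subsection \<open>Linear recurrences\<close>

text \<open>Sequences form a module over the polynomial ring, with the indeterminate acting as the
  shift; this is that action.\<close>

definition shift_op :: "'a::comm_ring_1 poly \<Rightarrow> (nat \<Rightarrow> 'a) \<Rightarrow> nat \<Rightarrow> 'a" where
  "shift_op P y n = (\<Sum>i\<le>degree P. coeff P i * y (n + i))"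

lemma shift_op_bound:
  assumes "degree P \<le> N"
  shows "shift_op P y n = (\<Sum>i\<le>N. coeff P i * y (n + i))"
  unfolding shift_op_def
  by (rule sum.mono_neutral_left) (use assms in \<open>auto simp: coeff_eq_0\<close>)

lemma shift_op_0 [simp]: "shift_op 0 y n = 0"
  by (simp add: shift_op_def)

lemma shift_op_1 [simp]: "shift_op 1 y n = y n"
  by (simp add: shift_op_def)

lemma shift_op_pCons [simp]: "shift_op (pCons a P) y n = a * y n + shift_op P y (Suc n)"
  unfolding shift_op_bound[OF degree_pCons_le]
  by (simp add: sum.atMost_Suc_shift shift_op_def del: sum.atMost_Suc)

lemma shift_op_add: "shift_op (P + Q) y n = shift_op P y n + shift_op Q y n"
  by (simp add: degree_add_le_max shift_op_bound[of _ "max (degree P) (degree Q)"]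
      distrib_right sum.distrib)

lemma shift_op_sum_left: "shift_op (\<Sum>k\<in>K. P k) y n = (\<Sum>k\<in>K. shift_op (P k) y n)"
  by (induction K rule: infinite_finite_induct) (simp_all add: shift_op_add)

lemma shift_op_smult: "shift_op (Polynomial.smult a P) y n = a * shift_op P y n"
  unfolding shift_op_bound[OF degree_smult_le]
  by (simp add: shift_op_def sum_distrib_left mult.assoc)

lemma shift_op_mult: "shift_op (P * Q) y n = shift_op P (shift_op Q y) n"
  by (induction P arbitrary: n) (simp_all add: shift_op_add shift_op_smult)

lemma shift_op_sum_right: "shift_op P (\<lambda>n. \<Sum>k\<in>K. y k n) n = (\<Sum>k\<in>K. shift_op P (y k) n)"
  unfolding shift_op_def sum_distrib_left by (rule sum.swap)

lemma shift_op_zero_right: "(\<And>n. y n = 0) \<Longrightarrow> shift_op P y n = 0"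
  by (simp add: shift_op_def)

text \<open>With the factor for \<open>\<mu>\<close> split off, the shift minus \<open>\<mu>\<close>
  turns \<open>y\<close> into an exponential polynomial by induction. Solving base by base gives a
  particular solution \<open>w\<close>, and \<open>y - w\<close> is a multiple of the powers of
  \<open>\<mu>\<close>. The extra coefficient of the resonant base is matched by the increase of
  \<open>count\<close> at \<open>\<mu>\<close>.\<close>

lemma linear_recurrence_solution:
  fixes y :: "nat \<Rightarrow> 'a::field_char_0"
  assumes "0 \<notin># M" "\<And>n. shift_op (\<Prod>x\<in>#M. [:- x, 1:]) y n = 0"
  shows "\<exists>q. (\<forall>\<nu>. \<forall>j\<ge>count M \<nu>. coeff (q \<nu>) j = 0) \<and>
             (\<forall>n. y n = (\<Sum>\<nu>\<in>set_mset M. \<nu> ^ n * poly (q \<nu>) (of_nat n)))"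
  using assms
proof (induction M arbitrary: y)
  case empty
  then show ?case
    by (intro exI[of _ "\<lambda>_. 0"]) (simp add: one_pCons)
next
  case (add \<mu> M)
  have "\<mu> \<noteq> 0" "0 \<notin># M"
    using add.prems(1) by auto
  have "shift_op (\<Prod>x\<in>#M. [:- x, 1:]) (shift_op [:- \<mu>, 1:] y) n = 0" for n
    using add.prems(2)[of n] by (simp add: shift_op_mult[symmetric] mult.commute
          del: shift_op_pCons mult_pCons_left mult_pCons_right)
  then obtain q where q: "\<And>\<nu> j. j \<ge> count M \<nu> \<Longrightarrow> coeff (q \<nu>) j = 0"
    and z: "\<And>n. shift_op [:- \<mu>, 1:] y n = (\<Sum>\<nu>\<in>set_mset M. \<nu> ^ n * poly (q \<nu>) (of_nat n))"
    using add.IH[OF \<open>0 \<notin># M\<close>] by blast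
  have "\<exists>r. (\<forall>j\<ge>count (add_mset \<mu> M) \<nu>. coeff r j = 0) \<and> exp_shift \<mu> \<nu> r = q \<nu>" for \<nu>
    using exp_shift_same_surj[OF \<open>\<mu> \<noteq> 0\<close>, of "count M \<nu>" "q \<nu>"]
      exp_shift_surj[of \<nu> \<mu> "count M \<nu>" "q \<nu>"] q[of \<nu>]
    by (cases "\<nu> = \<mu>") simp_all
  then obtain r where r: "\<And>\<nu> j. j \<ge> count (add_mset \<mu> M) \<nu> \<Longrightarrow> coeff (r \<nu>) j = 0"
    and shift_r: "\<And>\<nu>. exp_shift \<mu> \<nu> (r \<nu>) = q \<nu>"
    by metis
  let ?S = "set_mset (add_mset \<mu> M)"
  define w where "w n = (\<Sum>\<nu>\<in>?S. \<nu> ^ n * poly (r \<nu>) (of_nat n))" for n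
  \<comment> \<open>If \<open>\<mu>\<close> is a new base, its summand must vanish for the sums over
    \<open>M\<close> and over the enlarged multiset to agree.\<close>
  have q0: "q \<nu> = 0" if "\<nu> \<notin># M" for \<nu>
    using that q[of \<nu>] by (intro poly_eqI) (simp add: not_in_iff)
  have "w (Suc n) - \<mu> * w n = (\<Sum>\<nu>\<in>?S. \<nu> ^ n * poly (exp_shift \<mu> \<nu> (r \<nu>)) (of_nat n))" for n
    unfolding w_def
    by (subst sum_distrib_left, subst sum_subtractf[symmetric], rule sum.cong)
      (simp_all add: poly_exp_shift algebra_simps)
  also have "(\<Sum>\<nu>\<in>?S. \<nu> ^ n * poly (exp_shift \<mu> \<nu> (r \<nu>)) (of_nat n)) = shift_op [:- \<mu>, 1:] y n" for n
    unfolding shift_r z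
    by (rule sum.mono_neutral_right) (use q0 in auto)
  finally have wstep: "w (Suc n) - \<mu> * w n = y (Suc n) - \<mu> * y n" for n
    by simp
  define d where "d = y 0 - w 0"
  have d: "y n = w n + \<mu> ^ n * d" for n
  proof (induction n)
    case (Suc n)
    have "y (Suc n) = w (Suc n) + \<mu> * (y n - w n)"
      using wstep[of n] by (simp add: algebra_simps)
    then show ?case
      using Suc.IH by simp
  qed (simp add: d_def)
  \<comment> \<open>The homogeneous part is absorbed into the constant coefficient at
    \<open>\<mu>\<close>, which is available since the count of \<open>\<mu>\<close> is now
    positive.\<close>
  define r' where "r' = r(\<mu> := r \<mu> + [:d:])"
  have "y n = (\<Sum>\<nu>\<in>?S. \<nu> ^ n * poly (r' \<nu>) (of_nat n))" for n
  proof -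
    have "(\<Sum>\<nu>\<in>?S. \<nu> ^ n * poly (r' \<nu>) (of_nat n))
        = (\<Sum>\<nu>\<in>?S. \<nu> ^ n * poly (r \<nu>) (of_nat n) + (if \<nu> = \<mu> then \<mu> ^ n * d else 0))"
      by (rule sum.cong) (simp_all add: r'_def algebra_simps)
    also have "\<dots> = w n + \<mu> ^ n * d"
      unfolding sum.distrib w_def by (simp add: sum.delta)
    finally show ?thesis
      by (simp add: d)
  qed
  moreover have "coeff (r' \<nu>) j = 0" if "j \<ge> count (add_mset \<mu> M) \<nu>" for \<nu> j
    using that r[OF that] by (cases j) (auto simp: r'_def split: if_splits)
  ultimately show ?case
    by blast
qed

text \<open>
  Cayley--Hamilton for the shift operator: the vector of sequences is annihilated by the characteristic
  matrix with the shift in place of the indeterminate, hence by its determinant, which is the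
  adjugate times that matrix.
\<close>

lemma shift_op_char_poly:
  fixes B :: "'a::comm_ring_1 mat"
  assumes B: "B \<in> carrier_mat s s"
    and step: "\<And>n l. l < s \<Longrightarrow> y l (Suc n) = (\<Sum>k<s. B $$ (l, k) * y k n)"
    and "l < s"
  shows "shift_op (char_poly B) (y l) n = 0"
proof -
  define M where "M = char_poly_matrix B"
  have M: "M \<in> carrier_mat s s"
    using B by (simp add: M_def)
  have adj: "adj_mat M \<in> carrier_mat s s" and adj_mult: "adj_mat M * M = det M \<cdot>\<^sub>m 1\<^sub>m s"
    using adj_mat[OF M] by simp_all
  \<comment> \<open>Read with the shift as indeterminate, row \<open>j\<close> of the characteristic
    matrix is the recurrence for \<open>y j\<close>.\<close>
  have row: "(\<Sum>k<s. shift_op (M $$ (j, k)) (y k) n) = 0" if "j < s" for j n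
  proof -
    have "shift_op (M $$ (j, k)) (y k) n = (if k = j then y k (Suc n) else 0) - B $$ (j, k) * y k n"
      if "k < s" for k
      using that \<open>j < s\<close> B by (simp add: M_def char_poly_matrix_def)
    then show ?thesis
      using \<open>j < s\<close> step[of j n] by (simp add: sum_subtractf)
  qed
  have "shift_op (char_poly B) (y l) n = (\<Sum>k<s. shift_op ((det M \<cdot>\<^sub>m 1\<^sub>m s) $$ (l, k)) (y k) n)"
  proof -
    have "shift_op ((det M \<cdot>\<^sub>m 1\<^sub>m s) $$ (l, k)) (y k) n = (if k = l then shift_op (char_poly B) (y l) n else 0)"
      if "k < s" for k
      using that \<open>l < s\<close> by (simp add: char_poly_def M_def)
    then show ?thesis
      using \<open>l < s\<close> by simp
  qed
  also have "\<dots> = (\<Sum>k<s. \<Sum>j<s. shift_op (adj_mat M $$ (l, j)) (shift_op (M $$ (j, k)) (y k)) n)"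
    unfolding adj_mult[symmetric] using M adj \<open>l < s\<close>
    by (simp add: scalar_prod_def shift_op_sum_left shift_op_mult lessThan_atLeast0)
  also have "\<dots> = (\<Sum>j<s. shift_op (adj_mat M $$ (l, j)) (\<lambda>n. \<Sum>k<s. shift_op (M $$ (j, k)) (y k) n) n)"
    by (subst sum.swap) (simp add: shift_op_sum_right)
  also have "\<dots> = 0"
    by (simp add: row shift_op_zero_right)
  finally show ?thesis .
qed

section \<open>Invertibility, determinants and rearrangements of multisets\<close>

lemma invertible_mat_iff_det_nonzero:
  fixes B :: "'a::field mat"
  assumes B: "B \<in> carrier_mat n n"
  shows "invertible_mat B \<longleftrightarrow> det B \<noteq> 0"
proof
  assume "invertible_mat B"
  then obtain C where C: "B * C = 1\<^sub>m n" "C * B = 1\<^sub>m (dim_row C)"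
    using B by (auto simp: invertible_mat_def inverts_mat_def)
  then have "C \<in> carrier_mat n n"
    using B by (metis carrier_matD(2) carrier_matI index_mult_mat(3) index_one_mat(3))
  then have "det B * det C = 1"
    using det_mult[OF B] C(1) by (metis det_one)
  then show "det B \<noteq> 0"
    by auto
next
  assume "det B \<noteq> 0"
  have "inverse (det B) \<cdot>\<^sub>m adj_mat B \<in> carrier_mat n n"
    "B * (inverse (det B) \<cdot>\<^sub>m adj_mat B) = 1\<^sub>m n" "inverse (det B) \<cdot>\<^sub>m adj_mat B * B = 1\<^sub>m n"
    using adj_mat[OF B] \<open>det B \<noteq> 0\<close> B
    by (auto simp: mult_smult_distrib[OF B] mult_smult_assoc_mat[OF _ B] intro!: eq_matI)
  then show "invertible_mat B"
    unfolding invertible_mat_def inverts_mat_def using B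
    by (metis carrier_matD(1) carrier_matD(2) square_mat.simps)
qed

lemma poly_char_poly_0:
  fixes B :: "'a::field mat"
  assumes B: "B \<in> carrier_mat n n"
  shows "poly (char_poly B) 0 = 0 \<longleftrightarrow> det B = 0"
proof -
  have "char_matrix B 0 = B"
    using B by (auto simp: char_matrix_def intro!: eq_matI)
  then show ?thesis
    using char_poly_matrix[OF B, of 0] det_0_negate[OF B] by simp
qed

text \<open>A partition is listed in an unknown arrangement; this lifts any ordering of the
  multiplicities to an ordering of the eigenvalues.\<close>

lemma image_mset_eq_mset_imp_map:
  "image_mset f X = mset ys \<Longrightarrow> \<exists>xs. mset xs = X \<and> map f xs = ys"
proof (induction ys arbitrary: X)
  case (Cons y ys)
  then obtain X' x where "X = add_mset x X'" "f x = y" "image_mset f X' = mset ys"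
    using msed_map_invR[of f X y "mset ys"] by auto
  moreover then obtain xs where "mset xs = X'" "map f xs = ys"
    using Cons.IH by blast
  ultimately show ?case
    by (intro exI[of _ "x # xs"]) simp
qed simp

subsection \<open>The constraints\<close>

lemma ball_setcompr:
  "(\<forall>c\<in>{f x | x. P x}. Q c) \<longleftrightarrow> (\<forall>x. P x \<longrightarrow> Q (f x))"
  "(\<forall>c\<in>{g x y | x y. P' x y}. Q c) \<longleftrightarrow> (\<forall>x y. P' x y \<longrightarrow> Q (g x y))"
  "(\<forall>c\<in>{h x y z | x y z. P'' x y z}. Q c) \<longleftrightarrow> (\<forall>x y z. P'' x y z \<longrightarrow> Q (h x y z))"
  by blast+

lemma sym_mat_carrier: "sym_mat s \<in> carrier_mat s s"
  by (simp add: sym_mat_def)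

lemma sym_vec_carrier: "sym_vec s \<in> carrier_vec s"
  by (simp add: sym_vec_def)

section \<open>Meaning of each constraint family under a fixed assignment\<close>

context
  fixes \<sigma> :: "symb \<Rightarrow> 'a::field_char_0" and s :: nat and ms :: "nat list"
begin

interpretation ev: comm_ring_hom "mpoly_eval \<sigma>"
  by (rule comm_ring_hom_mpoly_eval)

interpretation evp: map_poly_comm_ring_hom "mpoly_eval \<sigma>" ..

definition sol_vec :: "'a vec" where
  "sol_vec = vec s (\<lambda>k. \<sigma> (Sa k))"

definition sol_mat :: "'a mat" where
  "sol_mat = mat s s (\<lambda>(k, l). \<sigma> (Sb k l))"

text \<open>The polynomial factor that accompanies the \<open>n\<close>-th power of the
  \<open>i\<close>-th root in entry \<open>l\<close> of the candidate solution.\<close>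

definition sol_poly :: "nat \<Rightarrow> nat \<Rightarrow> 'a poly" where
  "sol_poly i l = (\<Sum>j=1..ms ! i. Polynomial.monom (\<sigma> (Sc i j l)) (j - 1))"

definition sol_seq :: "nat \<Rightarrow> nat \<Rightarrow> 'a" where
  "sol_seq l n = (\<Sum>i<length ms. \<sigma> (Sw i) ^ n * poly (sol_poly i l) (of_nat n))"

lemma sol_vec_carrier [simp]: "sol_vec \<in> carrier_vec s"
  by (simp add: sol_vec_def)

lemma sol_mat_carrier [simp]: "sol_mat \<in> carrier_mat s s"
  by (simp add: sol_mat_def)

lemma map_mat_sym_mat: "map_mat (mpoly_eval \<sigma>) (sym_mat s) = sol_mat"
  by (rule eq_matI) (auto simp: sym_mat_def sol_mat_def)

lemma map_vec_sym_vec: "map_vec (mpoly_eval \<sigma>) (sym_vec s) = sol_vec"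
  by (rule eq_vecI) (auto simp: sym_vec_def sol_vec_def)

lemma coeff_sol_poly:
  "coeff (sol_poly i l) e = (if e < ms ! i then \<sigma> (Sc i (Suc e) l) else 0)"
proof -
  have "coeff (sol_poly i l) e = (\<Sum>j=1..ms ! i. if j = Suc e then \<sigma> (Sc i j l) else 0)"
    unfolding sol_poly_def coeff_sum by (rule sum.cong) auto
  then show ?thesis
    by (simp add: sum.delta Suc_le_eq)
qed

lemma satisfies_C_roots_iff:
  "satisfies \<sigma> (C_roots s ms) \<longleftrightarrow>
     char_poly sol_mat = (\<Prod>i<length ms. [:- \<sigma> (Sw i), 1:] ^ (ms ! i)) \<and>
     inj_on (\<lambda>i. \<sigma> (Sw i)) {..<length ms} \<and> (\<forall>i<length ms. \<sigma> (Sw i) \<noteq> 0)"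
proof -
  let ?D = "char_poly (sym_mat s) - (\<Prod>i<length ms. [:- mvar (Sw i), 1:] ^ (ms ! i))"
  have "map_poly (mpoly_eval \<sigma>) ?D
      = char_poly sol_mat - (\<Prod>i<length ms. [:- \<sigma> (Sw i), 1:] ^ (ms ! i))"
    by (simp add: ev.char_poly_hom[OF sym_mat_carrier, symmetric] evp.hom_minus evp.hom_prod evp.hom_power map_mat_sym_mat ev.hom_uminus)
  moreover have "(\<forall>c\<in>set (coeffs ?D). mpoly_eval \<sigma> c = 0) \<longleftrightarrow> map_poly (mpoly_eval \<sigma>) ?D = 0"
  proof -
    \<comment> \<open>Adding 0 turns the coefficient list into the whole range of
      \<open>coeff\<close>, so the condition becomes an equality of polynomials.\<close>
    have "(\<forall>c\<in>set (coeffs ?D). mpoly_eval \<sigma> c = 0) \<longleftrightarrow> (\<forall>c\<in>insert 0 (set (coeffs ?D)). mpoly_eval \<sigma> c = 0)"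
      by simp
    also have "\<dots> \<longleftrightarrow> map_poly (mpoly_eval \<sigma>) ?D = 0"
      unfolding range_coeff[symmetric] by (auto simp: poly_eq_iff)
    finally show ?thesis .
  qed
  moreover have "satisfies \<sigma> (C_roots s ms) \<longleftrightarrow>
      (\<forall>c\<in>set (coeffs ?D). mpoly_eval \<sigma> c = 0) \<and>
      inj_on (\<lambda>i. \<sigma> (Sw i)) {..<length ms} \<and> (\<forall>i<length ms. \<sigma> (Sw i) \<noteq> 0)"
    unfolding satisfies_def C_roots_def ball_Un inj_on_def ball_setcompr ball_simps holds.simps
      ev.hom_minus mpoly_eval_mvar right_minus_eq
    by blast
  ultimately show ?thesis
    by simp
qed

text \<open>By the binomial expansion, the sums in the constraints are the coefficients of the
  shifted polynomial. The constraints thus say that the block of each single root satisfies the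
  matrix recurrence on its own.\<close>

lemma satisfies_C_coeff_iff:
  "satisfies \<sigma> (C_coeff s ms) \<longleftrightarrow>
     (\<forall>i<length ms. \<forall>l<s. Polynomial.smult (\<sigma> (Sw i)) (pcompose (sol_poly i l) [:1, 1:])
        = (\<Sum>k<s. Polynomial.smult (\<sigma> (Sb l k)) (sol_poly i k)))"
proof -
  let ?lhs = "\<lambda>i l j. \<Sum>k=j..ms ! i. of_nat ((k - 1) choose (j - 1)) * \<sigma> (Sc i k l) * \<sigma> (Sw i)"
  let ?rhs = "\<lambda>i l j. \<Sum>k<s. \<sigma> (Sb l k) * \<sigma> (Sc i j k)"
  have "mpoly_eval \<sigma> ((\<Sum>k=j..ms ! i. of_nat ((k - 1) choose (j - 1)) * (sym_C s i k $ l) * mvar (Sw i))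
          - (sym_mat s *\<^sub>v sym_C s i j) $ l) = ?lhs i l j - ?rhs i l j" if "l < s" for i j l
    using that
    by (simp add: ev.hom_minus ev.hom_sum ev.hom_mult ev.hom_of_nat sym_C_def sym_mat_def
        scalar_prod_def lessThan_atLeast0)
  note eval = this
  have "satisfies \<sigma> (C_coeff s ms) \<longleftrightarrow>
      (\<forall>i j l. i < length ms \<and> 1 \<le> j \<and> j \<le> ms ! i \<and> l < s \<longrightarrow> ?lhs i l j - ?rhs i l j = 0)"
    unfolding satisfies_def C_coeff_def ball_setcompr holds.simps
    by (intro all_cong1 imp_cong refl) (simp only: eval)
  also have "\<dots> \<longleftrightarrow> (\<forall>i<length ms. \<forall>l<s. \<forall>j. 1 \<le> j \<and> j \<le> ms ! i \<longrightarrow> ?lhs i l j = ?rhs i l j)"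
    unfolding right_minus_eq by blast
  finally have "satisfies \<sigma> (C_coeff s ms) \<longleftrightarrow>
      (\<forall>i<length ms. \<forall>l<s. \<forall>j. 1 \<le> j \<and> j \<le> ms ! i \<longrightarrow> ?lhs i l j = ?rhs i l j)" .
  moreover have "(\<forall>j. 1 \<le> j \<and> j \<le> ms ! i \<longrightarrow> ?lhs i l j = ?rhs i l j) \<longleftrightarrow>
      Polynomial.smult (\<sigma> (Sw i)) (pcompose (sol_poly i l) [:1, 1:])
        = (\<Sum>k<s. Polynomial.smult (\<sigma> (Sb l k)) (sol_poly i k))" (is "_ \<longleftrightarrow> ?P = ?Q") for i l
  proof -
    have bound: "\<forall>j\<ge>ms ! i. coeff (sol_poly i l) j = 0"
      by (simp add: coeff_sol_poly)
    \<comment> \<open>The offset arises because the symbols are numbered from 1 and coefficients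
      from 0; summands with \<open>k\<close> below \<open>Suc e\<close> have a vanishing binomial
      coefficient.\<close>
    have P: "coeff ?P e = ?lhs i l (Suc e)" for e
    proof -
      have "?lhs i l (Suc e) = (\<Sum>k=1..ms ! i. of_nat ((k - 1) choose e) * \<sigma> (Sc i k l) * \<sigma> (Sw i))"
        by (rule sum.mono_neutral_cong_left) (auto simp: binomial_eq_0)
      also have "\<dots> = (\<Sum>k<ms ! i. of_nat (k choose e) * \<sigma> (Sc i (Suc k) l) * \<sigma> (Sw i))"
        by (rule sum.reindex_bij_witness[of _ Suc "\<lambda>k. k - 1"]) auto
      also have "\<dots> = coeff ?P e"
        by (simp add: coeff_pcompose_shift[OF bound] coeff_sol_poly sum_distrib_left algebra_simps)
      finally show ?thesis ..
    qed
    have Q: "coeff ?Q e = (if e < ms ! i then ?rhs i l (Suc e) else 0)" for e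
      by (simp add: coeff_sum coeff_sol_poly)
    have Suc_iff: "(\<forall>e. e < ms ! i \<longrightarrow> R (Suc e)) \<longleftrightarrow> (\<forall>j. 1 \<le> j \<and> j \<le> ms ! i \<longrightarrow> R j)" for R
    proof (intro iffI allI impI)
      show "R j" if "\<forall>e. e < ms ! i \<longrightarrow> R (Suc e)" "1 \<le> j \<and> j \<le> ms ! i" for j
        using that by (cases j) auto
    qed auto
    have "?P = ?Q \<longleftrightarrow> (\<forall>e. e < ms ! i \<longrightarrow> ?lhs i l (Suc e) = ?rhs i l (Suc e))"
      unfolding poly_eq_iff P Q by auto
    also have "\<dots> \<longleftrightarrow> (\<forall>j. 1 \<le> j \<and> j \<le> ms ! i \<longrightarrow> ?lhs i l j = ?rhs i l j)"
      by (rule Suc_iff)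
    finally show ?thesis ..
  qed
  ultimately show ?thesis
    by simp
qed

lemma satisfies_C_init_iff:
  "satisfies \<sigma> (C_init s ms) \<longleftrightarrow> (\<forall>n<s. \<forall>l<s. sol_seq l n = ((sol_mat ^\<^sub>m n) *\<^sub>v sol_vec) $ l)"
proof -
  have "mpoly_eval \<sigma> ((\<Sum>i<length ms. \<Sum>j=1..ms ! i.
                 (sym_C s i j $ l) * mvar (Sw i) ^ n * of_nat n ^ (j - 1))
              - ((sym_mat s ^\<^sub>m n) *\<^sub>v sym_vec s) $ l)
        = sol_seq l n - ((sol_mat ^\<^sub>m n) *\<^sub>v sol_vec) $ l" if "l < s" for l n
  proof -
    note carrier = sym_mat_carrier sym_vec_carrier
    have "map_vec (mpoly_eval \<sigma>) ((sym_mat s ^\<^sub>m n) *\<^sub>v sym_vec s) = (sol_mat ^\<^sub>m n) *\<^sub>v sol_vec"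
      by (subst ev.mult_mat_vec_hom[of _ s s])
        (simp_all add: carrier ev.mat_hom_pow[of _ s] map_mat_sym_mat map_vec_sym_vec)
    moreover have "dim_vec ((sym_mat s ^\<^sub>m n) *\<^sub>v sym_vec s) = s"
      using carrier_matD(1)[OF pow_carrier_mat[OF sym_mat_carrier[of s], of n]] by simp
    ultimately have "mpoly_eval \<sigma> (((sym_mat s ^\<^sub>m n) *\<^sub>v sym_vec s) $ l) = ((sol_mat ^\<^sub>m n) *\<^sub>v sol_vec) $ l"
      using \<open>l < s\<close> index_map_vec(1) by metis
    moreover have "mpoly_eval \<sigma> (\<Sum>i<length ms. \<Sum>j=1..ms ! i.
        (sym_C s i j $ l) * mvar (Sw i) ^ n * of_nat n ^ (j - 1)) = sol_seq l n"
      using that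
      by (simp add: ev.hom_sum ev.hom_mult ev.hom_power ev.hom_of_nat sym_C_def sol_seq_def
          sol_poly_def poly_sum poly_monom sum_distrib_left algebra_simps)
    ultimately show ?thesis
      by (simp add: ev.hom_minus)
  qed
  note eval = this
  have "satisfies \<sigma> (C_init s ms) \<longleftrightarrow>
      (\<forall>n l. n < s \<and> l < s \<longrightarrow> sol_seq l n - ((sol_mat ^\<^sub>m n) *\<^sub>v sol_vec) $ l = 0)"
    unfolding satisfies_def C_init_def ball_setcompr holds.simps
    by (intro all_cong1 imp_cong refl) (simp only: eval)
  then show ?thesis
    unfolding right_minus_eq by blast
qed

text \<open>For fixed \<open>n\<close>, replacing each formal monomial by the \<open>n\<close>-th
  power of its value and the indeterminate by the number \<open>n\<close> is a ring homomorphism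
  \<open>g\<close>. It commutes with the substitution into \<open>p\<close> and sends
  \<open>formal_xhat\<close> to \<open>sol_seq\<close>.\<close>

lemma eval_formal_expansion:
  assumes "mvars p \<subseteq> XV ` {..<s} \<union> YV ` {..<s}"
  defines "F \<equiv> formal_expansion s p ms"
  shows "(\<Sum>w\<in>Poly_Mapping.keys F. monom_value (\<lambda>i. \<sigma> (Sw i)) w ^ n
            * poly (map_poly (mpoly_eval \<sigma>) (Poly_Mapping.lookup F w)) (of_nat n))
       = mpoly_eval (\<lambda>v. case v of XV k \<Rightarrow> sol_seq k n | YV k \<Rightarrow> \<sigma> (Sa k)) p"
proof -
  define h where "h P = mpoly_eval \<sigma> (poly P (of_nat n))" for P
  have "comm_ring_hom h"
    unfolding h_def by (intro comm_ring_hom_comp[OF comm_ring_hom_mpoly_eval comm_ring_hom_poly])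
  then interpret h: comm_ring_hom h .
  define g where "g = mpoly_subst h (\<lambda>i. \<sigma> (Sw i) ^ n)"
  interpret g: comm_ring_hom g
    unfolding g_def by (rule h.comm_ring_hom_mpoly_subst)
  have g_single: "g (Poly_Mapping.single w P) = h P * monom_value (\<lambda>i. \<sigma> (Sw i)) w ^ n" for w P
    by (simp add: g_def h.mpoly_subst_single monom_value_power)
  have h_eq: "h P = poly (map_poly (mpoly_eval \<sigma>) P) (of_nat n)" for P
    using ev.poly_map_poly[of P "of_nat n"] by (simp add: h_def ev.hom_of_nat)
  have "g (formal_xhat s ms k) = sol_seq k n" if "k < s" for k
    using that
    by (simp add: formal_xhat_def g.hom_sum g_single sol_seq_def sol_poly_def h_def poly_monom
        poly_sum sym_C_def ev.hom_mult ev.hom_power ev.hom_of_nat sum_distrib_left algebra_simps)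
  \<comment> \<open>Vector entries are meaningful only below \<open>s\<close>; the condition on the
    variables of \<open>p\<close> keeps all indices in this range.\<close>
  then have "g F = mpoly_subst (\<lambda>c. c) (\<lambda>v. case v of XV k \<Rightarrow> sol_seq k n | YV k \<Rightarrow> \<sigma> (Sa k)) p"
    unfolding F_def formal_expansion_def g.hom_mpoly_subst
    using assms(1)
    by (subst mpoly_subst_cong[where g = "\<lambda>v. case v of XV k \<Rightarrow> sol_seq k n | YV k \<Rightarrow> \<sigma> (Sa k)"])
      (auto simp: g_single h_def sym_vec_def)
  then show ?thesis
    by (simp add: g_def mpoly_subst_def[of h] mpoly_eval_def h_eq monom_value_power mult.commute)
qed

text \<open>The finite ranges of the constraints lose nothing: coefficients above
  \<open>expansion_degree\<close> are zero, larger \<open>r\<close> follow from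
  \<open>sum_powers_eq_0_if_initial\<close>, and monomials outside \<open>expansion_monoms\<close>
  contribute zero.\<close>

lemma satisfies_C_alg_iff_coeff_sums:
  fixes p :: "(xyvar, 'a) mpoly"
  defines "F \<equiv> formal_expansion s p ms"
  shows "satisfies \<sigma> (C_alg s p ms) \<longleftrightarrow>
     (\<forall>e r. (\<Sum>w\<in>Poly_Mapping.keys F. monom_value (\<lambda>i. \<sigma> (Sw i)) w ^ r
        * coeff (map_poly (mpoly_eval \<sigma>) (Poly_Mapping.lookup F w)) e) = 0)"
proof -
  define W where "W = monom_value (\<lambda>i. \<sigma> (Sw i))"
  define U where "U w = map_poly (mpoly_eval \<sigma>) (Poly_Mapping.lookup F w)" for w
  let ?K = "Poly_Mapping.keys F"
  have sub: "expansion_monoms F e \<subseteq> ?K" for e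
    by (auto simp: expansion_monoms_def expansion_coeff_def in_keys_iff)
  then have fin: "finite (expansion_monoms F e)" for e
    using finite_keys finite_subset by blast
  have coeff_U: "coeff (U w) e = mpoly_eval \<sigma> (expansion_coeff F e w)" for w e
    by (simp add: U_def expansion_coeff_def)
  have restrict: "(\<Sum>w\<in>?K. W w ^ r * coeff (U w) e) = (\<Sum>w\<in>expansion_monoms F e. W w ^ r * coeff (U w) e)"
    for e r
    by (rule sum.mono_neutral_right) (use sub in \<open>auto simp: coeff_U expansion_monoms_def\<close>)
  have "mpoly_eval \<sigma> (\<Sum>w\<in>expansion_monoms F e. monom_value (\<lambda>i. mvar (Sw i)) w ^ r * expansion_coeff F e w)
      = (\<Sum>w\<in>expansion_monoms F e. W w ^ r * coeff (U w) e)" for e r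
    by (simp add: ev.hom_sum ev.hom_mult ev.hom_power ev.hom_monom_value coeff_U W_def)
  note eval = this
  have "satisfies \<sigma> (C_alg s p ms) \<longleftrightarrow>
      (\<forall>e\<le>expansion_degree F. \<forall>r<card (expansion_monoms F e).
         (\<Sum>w\<in>expansion_monoms F e. W w ^ r * coeff (U w) e) = 0)"
    unfolding satisfies_def C_alg_def F_def[symmetric] Let_def ball_setcompr holds.simps eval by blast
  also have "\<dots> \<longleftrightarrow> (\<forall>e r. (\<Sum>w\<in>?K. W w ^ r * coeff (U w) e) = 0)"
  proof -
    have "expansion_monoms F e = {}" if "e > expansion_degree F" for e
    proof -
      have "degree (Poly_Mapping.lookup F w) \<le> expansion_degree F" for w
        unfolding expansion_degree_def
        by (cases "w \<in> ?K") (auto intro!: Max_ge simp: in_keys_iff)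
      then have "coeff (Poly_Mapping.lookup F w) e = 0" for w
        using that by (intro coeff_eq_0) (rule le_less_trans)
      then show ?thesis
        by (simp add: expansion_monoms_def expansion_coeff_def)
    qed
    note monoms_empty = this
    have "(\<Sum>w\<in>expansion_monoms F e. W w ^ r * coeff (U w) e) = 0"
      if "\<forall>e\<le>expansion_degree F. \<forall>r<card (expansion_monoms F e).
            (\<Sum>w\<in>expansion_monoms F e. W w ^ r * coeff (U w) e) = 0" for e r
    proof (cases "e \<le> expansion_degree F")
      case True
      show ?thesis
        by (rule sum_powers_eq_0_if_initial[OF fin]) (use that True in blast)
    qed (simp add: monoms_empty)
    then show ?thesis
      unfolding restrict by blast
  qed
  finally show ?thesis
    unfolding W_def U_def .
qed

lemma satisfies_C_alg_imp_invariant: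
  assumes "mvars p \<subseteq> XV ` {..<s} \<union> YV ` {..<s}" "satisfies \<sigma> (C_alg s p ms)"
  shows "mpoly_eval (\<lambda>v. case v of XV k \<Rightarrow> sol_seq k n | YV k \<Rightarrow> \<sigma> (Sa k)) p = 0"
  unfolding eval_formal_expansion[OF assms(1), symmetric]
  by (rule exp_poly_eq_0_if_coeff_sums_eq_0)
    (use assms(2) in \<open>simp_all add: satisfies_C_alg_iff_coeff_sums\<close>)

text \<open>Asking for nonzero values at every index \<open>i\<close> makes all monomial values
  nonzero without tracking which indices occur in the expansion.\<close>

lemma invariant_imp_satisfies_C_alg:
  assumes "mvars p \<subseteq> XV ` {..<s} \<union> YV ` {..<s}" "\<And>i. \<sigma> (Sw i) \<noteq> 0"
    and "\<And>n. mpoly_eval (\<lambda>v. case v of XV k \<Rightarrow> sol_seq k n | YV k \<Rightarrow> \<sigma> (Sa k)) p = 0"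
  shows "satisfies \<sigma> (C_alg s p ms)"
  unfolding satisfies_C_alg_iff_coeff_sums
  by (intro allI exp_poly_coeff_sums_eq_0)
    (simp_all add: eval_formal_expansion[OF assms(1)] assms(2,3), simp add: monom_value_def assms(2))

end

subsection \<open>Soundness and completeness\<close>

text \<open>An exact solver is specified on finite constraint sets only.\<close>

lemma finite_constraints:
  fixes p :: "(xyvar, 'a::comm_ring_1) mpoly"
  shows "finite (constraints s p ms)"
proof -
  have "finite (C_roots s ms :: 'a constraint set)"
  proof -
    have "{NeqZero (mvar (Sw i) - mvar (Sw j)) | i j. i < length ms \<and> j < length ms \<and> i \<noteq> j}
        \<subseteq> (\<lambda>(i, j). NeqZero (mvar (Sw i) - mvar (Sw j) :: 'a spoly)) ` ({..<length ms} \<times> {..<length ms})"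
      by auto
    then have "finite {NeqZero (mvar (Sw i) - mvar (Sw j) :: 'a spoly) | i j. i < length ms \<and> j < length ms \<and> i \<noteq> j}"
      by (rule finite_subset) simp
    then show ?thesis
      by (simp add: C_roots_def)
  qed
  moreover have "finite (C_coeff s ms :: 'a constraint set)"
  proof -
    let ?f = "\<lambda>(i, j, l). EqZero ((\<Sum>k=j..ms ! i. of_nat ((k - 1) choose (j - 1)) * (sym_C s i k $ l) * mvar (Sw i))
              - (sym_mat s *\<^sub>v sym_C s i j) $ l :: 'a spoly)"
    have "C_coeff s ms \<subseteq> ?f ` (SIGMA i:{..<length ms}. {..ms ! i} \<times> {..<s})"
      unfolding C_coeff_def by force
    then show ?thesis
      by (rule finite_subset) auto
  qed
  moreover have "finite (C_init s ms :: 'a constraint set)"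
    unfolding C_init_def by (rule finite_image_set2) simp_all
  moreover have "finite (C_alg s p ms)"
  proof -
    define F where "F = formal_expansion s p ms"
    let ?f = "\<lambda>(e, r). EqZero (\<Sum>w\<in>expansion_monoms F e.
                 monom_value (\<lambda>i. mvar (Sw i)) w ^ r * expansion_coeff F e w)"
    have "C_alg s p ms \<subseteq> ?f ` (SIGMA e:{..expansion_degree F}. {..<card (expansion_monoms F e)})"
      unfolding C_alg_def F_def[symmetric] Let_def by force
    then show ?thesis
      by (rule finite_subset) auto
  qed
  ultimately show ?thesis
    by (simp add: constraints_def)
qed

section \<open>Sequences generated by a matrix\<close>

lemma lin_seq_carrier [simp]:
  "A \<in> carrier_vec s \<Longrightarrow> B \<in> carrier_mat s s \<Longrightarrow> lin_seq A B n \<in> carrier_vec s"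
  by (induction n) auto

lemma lin_seq_Suc_index:
  assumes "A \<in> carrier_vec s" "B \<in> carrier_mat s s" "l < s"
  shows "lin_seq A B (Suc n) $ l = (\<Sum>k<s. B $$ (l, k) * lin_seq A B n $ k)"
  using assms
  by (simp add: carrier_vecD[OF lin_seq_carrier[OF assms(1,2)]] scalar_prod_def lessThan_atLeast0)

text \<open>Matrix powers grow by a factor on the right, so comparing them with
  \<open>lin_seq\<close> requires moving one step into the initial vector.\<close>

lemma lin_seq_Suc_shift: "lin_seq A B (Suc n) = lin_seq (B *\<^sub>v A) B n"
  by (induction n) simp_all

lemma pow_mat_mult_vec:
  assumes "A \<in> carrier_vec s" "B \<in> carrier_mat s s"
  shows "(B ^\<^sub>m n) *\<^sub>v A = lin_seq A B n"
  using assms(1)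
proof (induction n arbitrary: A)
  case (Suc n)
  have "(B ^\<^sub>m Suc n) *\<^sub>v A = (B ^\<^sub>m n) *\<^sub>v (B *\<^sub>v A)"
    using assoc_mult_mat_vec[OF pow_carrier_mat[OF assms(2), of n] assms(2) Suc.prems] by simp
  also have "\<dots> = lin_seq A B (Suc n)"
    using Suc assms(2) unfolding lin_seq_Suc_shift by (intro Suc.IH) simp
  finally show ?case .
qed (use assms(2) in simp)

lemma poly_invariant_cong:
  assumes "mvars p \<subseteq> XV ` {..<s} \<union> YV ` {..<s}"
    and "\<And>n l. l < s \<Longrightarrow> y l n = lin_seq A B n $ l" "\<And>l. l < s \<Longrightarrow> a l = A $ l"
  shows "poly_invariant p A B \<longleftrightarrow>
    (\<forall>n. mpoly_eval (\<lambda>v. case v of XV k \<Rightarrow> y k n | YV k \<Rightarrow> a k) p = 0)"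
proof -
  have "mpoly_eval (\<lambda>v. case v of XV k \<Rightarrow> y k n | YV k \<Rightarrow> a k) p
      = mpoly_eval (\<lambda>v. case v of XV k \<Rightarrow> lin_seq A B n $ k | YV k \<Rightarrow> lin_seq A B 0 $ k) p" for n
    unfolding mpoly_eval_def
    by (rule mpoly_subst_cong) (use assms in auto)
  then show ?thesis
    by (simp add: poly_invariant_def)
qed

lemma satisfies_constraints_sound:
  fixes \<sigma> :: "symb \<Rightarrow> 'a::field_char_0"
  assumes "s \<ge> 1" "mvars p \<subseteq> XV ` {..<s} \<union> YV ` {..<s}" "satisfies \<sigma> (constraints s p ms)"
  shows "invertible_mat (sol_mat \<sigma> s) \<and> poly_invariant p (sol_vec \<sigma> s) (sol_mat \<sigma> s)"
proof -
  let ?A = "sol_vec \<sigma> s" and ?B = "sol_mat \<sigma> s"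
  have sat: "satisfies \<sigma> (C_roots s ms)" "satisfies \<sigma> (C_coeff s ms)"
    "satisfies \<sigma> (C_init s ms)" "satisfies \<sigma> (C_alg s p ms)"
    using assms(3) by (auto simp: constraints_def satisfies_def)
  \<comment> \<open>All roots are nonzero, so 0 is not an eigenvalue.\<close>
  have "poly (char_poly ?B) 0 \<noteq> 0"
    using sat(1) unfolding satisfies_C_roots_iff by (auto simp: poly_prod)
  then have "invertible_mat ?B"
    by (simp add: poly_char_poly_0[of _ s] invertible_mat_iff_det_nonzero[of _ s])
  have seq: "sol_seq \<sigma> ms l n = lin_seq ?A ?B n $ l" if "l < s" for l n
    using that
  proof (induction n arbitrary: l)
    case 0
    then show ?case
      \<comment> \<open>Since \<open>s\<close> is positive, the initial constraints include the one
        for \<open>n = 0\<close>; later values come from the coefficient constraints.\<close>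
      using sat(3) assms(1)
      unfolding satisfies_C_init_iff pow_mat_mult_vec[OF sol_vec_carrier sol_mat_carrier] by simp
  next
    case (Suc n)
    let ?q = "sol_poly \<sigma> ms"
    have step: "\<sigma> (Sw i) * poly (?q i l) (of_nat (Suc n)) = (\<Sum>k<s. \<sigma> (Sb l k) * poly (?q i k) (of_nat n))"
      if "i < length ms" for i
    proof -
      have "Polynomial.smult (\<sigma> (Sw i)) (pcompose (?q i l) [:1, 1:])
          = (\<Sum>k<s. Polynomial.smult (\<sigma> (Sb l k)) (?q i k))"
        using sat(2) that Suc.prems unfolding satisfies_C_coeff_iff by blast
      from arg_cong[OF this, of "\<lambda>P. poly P (of_nat n)"] show ?thesis
        by (simp add: poly_pcompose poly_sum)
    qed
    have "sol_seq \<sigma> ms l (Suc n)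
        = (\<Sum>i<length ms. \<sigma> (Sw i) ^ n * (\<sigma> (Sw i) * poly (?q i l) (of_nat (Suc n))))"
      by (simp add: sol_seq_def algebra_simps)
    also have "\<dots> = (\<Sum>i<length ms. \<Sum>k<s. \<sigma> (Sb l k) * (\<sigma> (Sw i) ^ n * poly (?q i k) (of_nat n)))"
      by (intro sum.cong refl) (simp add: step sum_distrib_left algebra_simps del: of_nat_Suc)
    also have "\<dots> = (\<Sum>k<s. \<sigma> (Sb l k) * sol_seq \<sigma> ms k n)"
      by (subst sum.swap) (simp add: sol_seq_def sum_distrib_left)
    also have "\<dots> = (\<Sum>k<s. ?B $$ (l, k) * lin_seq ?A ?B n $ k)"
      using Suc by (intro sum.cong) (simp_all add: sol_mat_def)
    also have "\<dots> = lin_seq ?A ?B (Suc n) $ l"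
      using Suc.prems by (intro lin_seq_Suc_index[symmetric]) simp_all
    finally show ?case .
  qed
  have "poly_invariant p ?A ?B"
    by (subst poly_invariant_cong[OF assms(2) seq, where a = "\<lambda>k. \<sigma> (Sa k)"])
      (simp_all add: sol_vec_def satisfies_C_alg_imp_invariant[OF assms(2) sat(4)])
  with \<open>invertible_mat ?B\<close> show ?thesis
    by blast
qed

text \<open>\<open>M\<close> collects the multiplicities of the distinct eigenvalues of
  \<open>B\<close>. Every arrangement of \<open>M\<close> has to be covered, because the enumeration
  may list any one of them.\<close>

lemma satisfies_constraints_complete:
  fixes A :: "'a::{alg_closed_field, field_char_0} vec"
  assumes A: "A \<in> carrier_vec s" and B: "B \<in> carrier_mat s s" and "invertible_mat B"
    and vars: "mvars p \<subseteq> XV ` {..<s} \<union> YV ` {..<s}" and inv: "poly_invariant p A B"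
  shows "\<exists>M. 0 \<notin># M \<and> sum_mset M = s \<and>
           (\<forall>ms. mset ms = M \<longrightarrow> (\<exists>\<sigma>. satisfies \<sigma> (constraints s p ms)))"
proof -
  have deg: "degree (char_poly B) = s" and monic: "lead_coeff (char_poly B) = 1"
    using degree_monic_char_poly[OF B] by auto
  then have "char_poly B \<noteq> 0"
    by auto
  then obtain R where "size R = s" and R: "char_poly B = (\<Prod>x\<in>#R. [:- x, 1:])"
    using alg_closed_imp_factorization[of "char_poly B"] deg monic by auto
  have "poly (char_poly B) 0 \<noteq> 0"
    using \<open>invertible_mat B\<close> by (simp add: poly_char_poly_0[OF B] invertible_mat_iff_det_nonzero[OF B])
  then have "0 \<notin># R"
    by (auto simp: R poly_prod_mset)
  let ?S = "set_mset R"
  have "\<exists>q. (\<forall>\<nu>. \<forall>j\<ge>count R \<nu>. coeff (q \<nu>) j = 0) \<and>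
          (\<forall>n. lin_seq A B n $ l = (\<Sum>\<nu>\<in>?S. \<nu> ^ n * poly (q \<nu>) (of_nat n)))" if "l < s" for l
    using shift_op_char_poly[OF B, of "\<lambda>l n. lin_seq A B n $ l" l] lin_seq_Suc_index[OF A B] that
    by (intro linear_recurrence_solution[OF \<open>0 \<notin># R\<close>]) (simp add: R)
  then obtain q where q: "\<And>l \<nu> j. l < s \<Longrightarrow> j \<ge> count R \<nu> \<Longrightarrow> coeff (q l \<nu>) j = 0"
    and seq: "\<And>l n. l < s \<Longrightarrow> lin_seq A B n $ l = (\<Sum>\<nu>\<in>?S. \<nu> ^ n * poly (q l \<nu>) (of_nat n))"
    by metis
  \<comment> \<open>The matrix recurrence equates two exponential polynomials over the same distinct
    nonzero bases, so independence allows comparing them base by base.\<close>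
  have step: "Polynomial.smult \<nu> (pcompose (q l \<nu>) [:1, 1:]) = (\<Sum>k<s. Polynomial.smult (B $$ (l, k)) (q k \<nu>))"
    if "l < s" "\<nu> \<in> ?S" for l \<nu>
  proof -
    let ?d = "\<lambda>\<nu>. Polynomial.smult \<nu> (pcompose (q l \<nu>) [:1, 1:]) - (\<Sum>k<s. Polynomial.smult (B $$ (l, k)) (q k \<nu>))"
    have "(\<Sum>\<nu>\<in>?S. \<nu> ^ n * poly (?d \<nu>) (of_nat n)) = 0" for n
    proof -
      have "(\<Sum>k<s. B $$ (l, k) * lin_seq A B n $ k)
          = (\<Sum>k<s. \<Sum>\<nu>\<in>?S. B $$ (l, k) * (\<nu> ^ n * poly (q k \<nu>) (of_nat n)))"
        by (simp add: seq sum_distrib_left)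
      also have "\<dots> = (\<Sum>\<nu>\<in>?S. \<nu> ^ n * (\<Sum>k<s. B $$ (l, k) * poly (q k \<nu>) (of_nat n)))"
        by (subst sum.swap) (simp add: sum_distrib_left algebra_simps)
      finally have "(\<Sum>\<nu>\<in>?S. \<nu> ^ n * poly (?d \<nu>) (of_nat n))
          = lin_seq A B (Suc n) $ l - (\<Sum>k<s. B $$ (l, k) * lin_seq A B n $ k)"
        using seq[OF \<open>l < s\<close>, of "Suc n"]
        by (simp add: poly_pcompose poly_sum algebra_simps sum_subtractf del: lin_seq.simps)
      then show ?thesis
        using lin_seq_Suc_index[OF A B \<open>l < s\<close>] by simp
    qed
    then have "\<forall>\<nu>\<in>?S. ?d \<nu> = 0"
      using \<open>0 \<notin># R\<close> by (intro exp_poly_independent) auto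
    then show ?thesis
      using that(2) by simp
  qed
  define M where "M = image_mset (count R) (mset_set ?S)"
  have "0 \<notin># M"
    by (auto simp: M_def count_eq_zero_iff)
  moreover have "sum_mset M = s"
    using \<open>size R = s\<close> by (simp add: M_def size_multiset_overloaded_eq sum_unfold_sum_mset)
  moreover have "\<exists>\<sigma>. satisfies \<sigma> (constraints s p ms)" if ms: "mset ms = M" for ms
  proof -
    obtain ws where "mset ws = mset_set ?S" and count_ws: "map (count R) ws = ms"
      using image_mset_eq_mset_imp_map[of "count R" "mset_set ?S" ms] ms M_def by auto
    have set_ws: "set ws = ?S"
      using \<open>mset ws = mset_set ?S\<close> by (metis finite_set_mset finite_set_mset_mset_set set_mset_mset)
    have "distinct ws"
      unfolding distinct_count_atmost_1 by (simp add: \<open>mset ws = mset_set ?S\<close> set_ws count_mset_set')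
    have len: "length ws = length ms" and ms_nth: "\<And>i. i < length ms \<Longrightarrow> ms ! i = count R (ws ! i)"
      using count_ws by auto
    have ws_in: "ws ! i \<in> ?S" if "i < length ms" for i
      using that len set_ws nth_mem by metis
    have bij: "bij_betw (\<lambda>i. ws ! i) {..<length ms} ?S"
      using bij_betw_nth[OF \<open>distinct ws\<close>] len set_ws by auto
    \<comment> \<open>The value 1 for \<open>i \<ge> length ms\<close> makes every monomial in the \<open>Sw i\<close> nonzero.\<close>
    define \<sigma> where "\<sigma> v = (case v of Sa k \<Rightarrow> A $ k | Sb k l \<Rightarrow> B $$ (k, l)
        | Sw i \<Rightarrow> (if i < length ms then ws ! i else 1)
        | Sc i j k \<Rightarrow> coeff (q k (ws ! i)) (j - 1))" for v
    have [simp]: "\<sigma> (Sa k) = A $ k" "\<sigma> (Sb k l) = B $$ (k, l)"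
      "i < length ms \<Longrightarrow> \<sigma> (Sw i) = ws ! i" for i k l
      by (simp_all add: \<sigma>_def)
    have mat: "sol_mat \<sigma> s = B" and vec: "sol_vec \<sigma> s = A"
      using A B by (auto simp: sol_mat_def sol_vec_def intro!: eq_matI eq_vecI)
    \<comment> \<open>Truncation at the multiplicity is harmless, since the coefficients of
      \<open>q\<close> vanish from there on.\<close>
    have sol_poly: "sol_poly \<sigma> ms i l = q l (ws ! i)" if "i < length ms" "l < s" for i l
      using that q[of l "ws ! i"] by (intro poly_eqI) (simp add: coeff_sol_poly \<sigma>_def ms_nth)
    have sol_seq: "sol_seq \<sigma> ms l n = lin_seq A B n $ l" if "l < s" for l n
      unfolding seq[OF that] sol_seq_def using that
      by (subst sum.reindex_bij_betw[OF bij, symmetric]) (simp add: sol_poly)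
    have "satisfies \<sigma> (C_roots s ms)"
    proof -
      have "char_poly B = (\<Prod>\<nu>\<in>?S. [:- \<nu>, 1:] ^ count R \<nu>)"
        unfolding R by (rule image_prod_mset_multiplicity)
      also have "\<dots> = (\<Prod>i<length ms. [:- \<sigma> (Sw i), 1:] ^ (ms ! i))"
        by (subst prod.reindex_bij_betw[OF bij, symmetric]) (simp add: ms_nth)
      moreover have "inj_on (\<lambda>i. \<sigma> (Sw i)) {..<length ms}"
        using bij by (simp add: bij_betw_def inj_on_def)
      moreover have "\<sigma> (Sw i) \<noteq> 0" if "i < length ms" for i
        using ws_in[OF that] \<open>0 \<notin># R\<close> that by auto
      ultimately show ?thesis
        by (simp add: satisfies_C_roots_iff mat)
    qed
    moreover have "satisfies \<sigma> (C_coeff s ms)"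
      unfolding satisfies_C_coeff_iff by (simp add: sol_poly step ws_in)
    moreover have "satisfies \<sigma> (C_init s ms)"
      unfolding satisfies_C_init_iff mat vec by (simp add: pow_mat_mult_vec[OF A B] sol_seq)
    moreover have "satisfies \<sigma> (C_alg s p ms)"
    proof (rule invariant_imp_satisfies_C_alg[OF vars])
      show "\<sigma> (Sw i) \<noteq> 0" for i
        using ws_in[of i] \<open>0 \<notin># R\<close> by (auto simp: \<sigma>_def)
      show "mpoly_eval (\<lambda>v. case v of XV k \<Rightarrow> sol_seq \<sigma> ms k n | YV k \<Rightarrow> \<sigma> (Sa k)) p = 0" for n
        using inv poly_invariant_cong[OF vars, of "sol_seq \<sigma> ms" A B "\<lambda>k. \<sigma> (Sa k)"] sol_seq by simp
    qed
    ultimately show ?thesis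
      by (auto simp: constraints_def satisfies_def)
  qed
  ultimately show ?thesis
    by blast
qed

section \<open>From satisfiability to the output of the algorithm\<close>

lemma algorithm1_SomeD:
  assumes "exact_solver solve" "algorithm1 solve s p parts = Some (A, B)"
  shows "\<exists>ms \<sigma>. satisfies \<sigma> (constraints s p ms) \<and> A = sol_vec \<sigma> s \<and> B = sol_mat \<sigma> s"
  using assms(2)
proof (induction parts)
  case (Cons ms parts)
  show ?case
  proof (cases "solve (constraints s p ms)")
    case None
    then show ?thesis
      using Cons by simp
  next
    case (Some \<sigma>)
    then have "satisfies \<sigma> (constraints s p ms)"
      using assms(1) finite_constraints[of s p ms] by (auto simp: exact_solver_def split: option.splits)
    then show ?thesis
      using Cons.prems Some by (auto simp: sol_vec_def sol_mat_def)
  qed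
qed simp

lemma algorithm1_NoneD:
  assumes "exact_solver solve" "algorithm1 solve s p parts = None" "ms \<in> set parts"
  shows "\<not> satisfies \<sigma> (constraints s p ms)"
  using assms(2,3)
proof (induction parts)
  case (Cons ms' parts)
  then have "solve (constraints s p ms') = None" "algorithm1 solve s p parts = None"
    by (simp_all split: option.splits)
  then show ?case
    using Cons assms(1) finite_constraints[of s p ms] by (auto simp: exact_solver_def split: option.splits)
qed simp

theorem theorem7:
  fixes s :: nat
    and p :: "(xyvar, 'a::{alg_closed_field, field_char_0}) mpoly"
    and solve :: "'a solver"
    and parts :: "nat list list"
  assumes "s \<ge> 1"
    and "mvars p \<subseteq> XV ` {..<s} \<union> YV ` {..<s}"
    and "exact_solver solve"
    and "enumerates_partitions s parts"
  shows "(\<forall>A B. algorithm1 solve s p parts = Some (A, B) \<longrightarrow>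
             A \<in> carrier_vec s \<and> B \<in> carrier_mat s s \<and> invertible_mat B \<and> poly_invariant p A B)
       \<and> ((\<exists>A \<in> carrier_vec s. \<exists>B \<in> carrier_mat s s. invertible_mat B \<and> poly_invariant p A B)
             \<longrightarrow> algorithm1 solve s p parts \<noteq> None)"
proof (intro conjI allI impI)
  fix A B
  assume "algorithm1 solve s p parts = Some (A, B)"
  then obtain ms \<sigma> where "satisfies \<sigma> (constraints s p ms)" "A = sol_vec \<sigma> s" "B = sol_mat \<sigma> s"
    using algorithm1_SomeD[OF assms(3)] by blast
  then show "A \<in> carrier_vec s" "B \<in> carrier_mat s s" "invertible_mat B" "poly_invariant p A B"
    using satisfies_constraints_sound[OF assms(1,2)] by simp_all
next
  assume "\<exists>A \<in> carrier_vec s. \<exists>B \<in> carrier_mat s s. invertible_mat B \<and> poly_invariant p A B"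
  then obtain M where M: "0 \<notin># M" "sum_mset M = s"
    and sat: "\<And>ms. mset ms = M \<Longrightarrow> \<exists>\<sigma>. satisfies \<sigma> (constraints s p ms)"
    using satisfies_constraints_complete[OF _ _ _ assms(2)] by metis
  have "M \<in> mset ` set parts"
    using assms(4) M by (simp add: enumerates_partitions_def)
  then obtain ms where "ms \<in> set parts" "mset ms = M"
    by blast
  then show "algorithm1 solve s p parts \<noteq> None"
    using algorithm1_NoneD[OF assms(3)] sat by blast
qed

end
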